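(* For the Hawaiian Earring $Z=H(p_1,p_2,\dots)$ and for Griffiths' space $Y=G(p_1,q_1,p_2,q_2,\dots)$ there is a set $\mathcal K$ of $2^{\aleph_0}$ functions $k:\mathbb N\to\mathbb N$ such that (a) all the elements $[p_{k(1)},p_{k(2)}][p_{k(3)},p_{k(4)}]\dots$, $k\in\mathcal K$, are (defined and pairwise) different in $H_1(Z)$; (b) all the elements $[p_{k(1)},q_{k(1)}][p_{k(2)},q_{k(2)}]\dots$, $k\in\mathcal K$, are (defined and pairwise) different in $H_1(Y)$.
   Context: Spaces. Let $P=\{p_1,p_2,\dots\}$ and $Q=\{q_1,q_2,\dots\}$ be disjoint. The Hawaiian Earring $H(P)=H(p_1,p_2,\dots)$ is the union of circles of radii $1/n$ ($n\ge1$) in the plane, pairwise meeting only in one common base point, on the same side of a common tangent; the circle of radius $1/n$, and also the loop traversing it once counterclockwise, is called $p_n$; similarly $H(Q)$. Griffiths' space $G(p_1,q_1,p_2,q_2,\dots)$ is the one-point union of the cones over $H(P)$ and over $H(Q)$, glued at the base points of the two Earrings. $H_1$ denotes first singular homology (the abelianization of $\pi_1$). Infinite products. $[u,v]=u^{-1}v^{-1}uv$. An infinite product of commutators of letters as in (a), (b) denotes the countable word, ordered like $\mathbb N$, obtained by writing the commutators one after another. It defines an element when every letter occurs in it only finitely many times: such a word $(x_i)_{i\in\mathbb N}$ represents the class of the loop $f:[0,1]\to Z$ (respectively $f:[0,1]\to H(P)\vee H(Q)\subset Y$) obtained by choosing disjoint open intervals $J_i\subset(0,1)$ ordered like $\mathbb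 N$, traversing the loop $x_i$ (the inverse loop for an inverse letter) on $J_i$, and staying at the base point elsewhere; this class in $\pi_1$ is well defined, and the element of $H_1$ is its image under $\pi_1\to H_1$. *)

theory Defs
  imports "HOL-Analysis.Analysis" "HOL-Homology.Homology"
begin

text \<open>The Hawaiian Earring in the complex plane: base point \<open>0\<close>, the imaginary axis as common
  tangent, and all circles in the right half plane.\<close>

definition hawaiian_earring :: "complex set" where
  "hawaiian_earring = (\<Union>n\<in>{1::nat..}. sphere (of_real (1 / real n)) (1 / real n))"

text \<open>One counterclockwise traversal of the circle of radius \<open>1/n\<close>, starting at \<open>0\<close>; meaningful for
  \<open>n \<ge> 1\<close>.\<close>

definition circle_loop :: "nat \<Rightarrow> real \<Rightarrow> complex" where
  "circle_loop n t = of_real (1 / real n) * (1 - cis (2 * pi * t))"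

lemma path_image_circle_loop:
  assumes "n \<ge> 1"
  shows "path_image (circle_loop n) = sphere (of_real (1 / real n)) (1 / real n)"
proof (intro equalityI subsetI)
  fix z :: complex assume "z \<in> path_image (circle_loop n)"
  then obtain t where "z = circle_loop n t" by (auto simp: path_image_def)
  then have "of_real (1 / real n) - z = of_real (1 / real n) * cis (2 * pi * t)"
    by (simp add: circle_loop_def right_diff_distrib)
  then show "z \<in> sphere (of_real (1 / real n)) (1 / real n)"
    by (simp only: mem_sphere dist_norm norm_mult norm_of_real norm_cis) simp
next
  fix z :: complex assume "z \<in> sphere (of_real (1 / real n)) (1 / real n)"
  then have "cmod (1 / of_nat n - z) = 1 / real n" by (simp add: dist_norm)
  then have "cmod (of_nat n * (1 / of_nat n - z)) = 1"
    using assms unfolding norm_mult by simp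
  then have *: "cmod (1 - of_nat n * z) = 1"
    using assms by (simp add: right_diff_distrib)
  obtain t where t: "0 \<le> t" "t < 2 * pi"
    "1 - of_nat n * z = cis t"
    using * complex_unimodular_polar[OF *] by (metis cis.ctr)
  have "z = circle_loop n (t / (2 * pi))"
    using assms t(3)[symmetric] by (simp add: circle_loop_def field_simps)
  then show "z \<in> path_image (circle_loop n)"
    using t by (auto simp: path_image_def intro!: image_eqI)
qed

text \<open>The cone over a subset \<open>H\<close> of the plane, realised in \<open>\<complex> \<times> \<real>\<close> with base \<open>H \<times> {0}\<close> and apex
  \<open>(0, 1)\<close>. For compact \<open>H\<close> this is the topological cone \<open>(H \<times> [0,1]) / (H \<times> {1})\<close>; see
  \<open>quotient_map_cone\<close> and \<open>cone_map_eq_iff\<close>.\<close>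

definition cone_map :: "complex \<times> real \<Rightarrow> complex \<times> real" where
  "cone_map = (\<lambda>(z, s). ((1 - s) *\<^sub>R z, s))"

definition cone_over :: "complex set \<Rightarrow> (complex \<times> real) set" where
  "cone_over H = cone_map ` (H \<times> {0..1})"

lemma cone_map_eq_iff: "cone_map (z, s) = cone_map (w, t) \<longleftrightarrow> s = t \<and> (z = w \<or> s = 1)"
  by (auto simp: cone_map_def)

lemma quotient_map_cone:
  assumes "compact H"
  shows "quotient_map (top_of_set (H \<times> {0..1})) (top_of_set (cone_over H)) cone_map"
proof (rule continuous_closed_imp_quotient_map)
  have c: "continuous_on (H \<times> {0..1}) cone_map"
    unfolding cone_map_def case_prod_unfold by (intro continuous_intros)
  then show cm: "continuous_map (top_of_set (H \<times> {0..1})) (top_of_set (cone_over H)) cone_map"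
    by (auto simp: cone_over_def)
  show "closed_map (top_of_set (H \<times> {0..1})) (top_of_set (cone_over H)) cone_map"
    using assms cm by (intro continuous_imp_closed_map)
      (auto simp: compact_space_subtopology compact_Times compactin_euclidean_iff Hausdorff_space_subtopology)
  show "cone_map ` topspace (top_of_set (H \<times> {0..1})) = topspace (top_of_set (cone_over H))"
    by (simp add: cone_over_def)
qed

lemma compact_hawaiian_earring: "compact hawaiian_earring"
proof -
  have bd: "hawaiian_earring \<subseteq> cball 0 2"
  proof
    fix z :: complex assume "z \<in> hawaiian_earring"
    then obtain n :: nat where n: "n \<ge> 1" "dist (of_real (1 / real n)) z = 1 / real n"
      by (auto simp: hawaiian_earring_def)
    have "cmod z \<le> cmod (of_real (1 / real n)) + dist (of_real (1 / real n)) z"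
      by (metis add.commute dist_0_norm dist_commute dist_triangle)
    also have "\<dots> = 2 / real n" using n by (simp add: norm_divide)
    also have "\<dots> \<le> 2" using n by (simp add: divide_le_eq)
    finally show "z \<in> cball 0 2" by simp
  qed
  have "closed hawaiian_earring"
    unfolding closed_sequential_limits
  proof clarify
    fix x l assume x: "\<forall>n. x n \<in> hawaiian_earring" and l: "x \<longlonglongrightarrow> l"
    show "l \<in> hawaiian_earring"
    proof (cases "l = 0")
      case False
      define N where "N = nat \<lceil>4 / cmod l\<rceil>"
      define F where "F = (\<Union>n\<in>{1..N}. sphere (complex_of_real (1 / real n)) (1 / real n))"
      have "closed F" unfolding F_def by (intro closed_UN) auto
      moreover have "\<forall>\<^sub>F i in sequentially. x i \<in> F"
      proof -
        have "\<forall>\<^sub>F i in sequentially. cmod (x i) > cmod l / 2"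
          by (rule order_tendstoD(1)[OF tendsto_norm[OF l]]) (use False in simp)
        then show ?thesis
        proof eventually_elim
          case (elim i)
          obtain n :: nat where n: "n \<ge> 1" "x i \<in> sphere (of_real (1 / real n)) (1 / real n)"
            using x by (auto simp: hawaiian_earring_def)
          have "cmod (x i) \<le> cmod (of_real (1 / real n)) + dist (of_real (1 / real n)) (x i)"
            by (metis add.commute dist_0_norm dist_commute dist_triangle)
          also have "\<dots> = 2 / real n" using n by (simp add: norm_divide)
          finally have "cmod l / 2 < 2 / real n" using elim by linarith
          then have "real n < 4 / cmod l" using n False by (simp add: field_simps)
          then have "n \<le> N" unfolding N_def by linarith
          then show ?case using n unfolding F_def by (metis UN_I atLeastAtMost_iff)
        qed
      qed
      ultimately have "l \<in> F" using l Lim_in_closed_set trivial_limit_sequentially by blast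
      then show ?thesis unfolding F_def hawaiian_earring_def by auto
    qed (auto simp: hawaiian_earring_def norm_divide intro!: bexI[of _ "1::nat"])
  qed
  then show ?thesis
    using bd bounded_cball bounded_subset compact_eq_bounded_closed by blast
qed

text \<open>Griffiths' space. \<open>H(P)\<close> is \<open>hawaiian_earring \<times> {0}\<close>; \<open>H(Q)\<close> is its image under the point
  reflection \<open>x \<mapsto> -x\<close>, which maps the cone over \<open>H(P)\<close> to the cone over \<open>H(Q)\<close> with apex \<open>(0, -1)\<close>.
  The two cones are compact and meet only in \<open>(0, 0)\<close>, so that their union is the one-point union.\<close>

definition griffiths_space :: "(complex \<times> real) set" where
  "griffiths_space = cone_over hawaiian_earring \<union> uminus ` cone_over hawaiian_earring"

lemma cones_Int: "cone_over hawaiian_earring \<inter> uminus ` cone_over hawaiian_earring = {(0, 0)}"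
proof -
  have re: "Re z > 0 \<or> z = 0" if "z \<in> hawaiian_earring" for z
  proof -
    obtain n :: nat where "z \<in> sphere (of_real (1 / real n)) (1 / real n)"
      using \<open>z \<in> hawaiian_earring\<close> unfolding hawaiian_earring_def by (elim UN_E)
    then obtain c :: real where c: "cmod (of_real c - z) = c"
      unfolding mem_sphere dist_norm by metis
    have "(c - Re z)\<^sup>2 + (Im z)\<^sup>2 = (cmod (of_real c - z))\<^sup>2" by (simp add: cmod_power2)
    then have *: "(c - Re z)\<^sup>2 + (Im z)\<^sup>2 = c\<^sup>2" by (simp only: c)
    have "Re z \<ge> 0" using complex_Re_le_cmod[of "of_real c - z"] c by simp
    moreover have "z = 0" if "Re z = 0" using * that by (simp add: complex_eq_iff)
    ultimately show ?thesis by force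
  qed
  have "0 \<in> hawaiian_earring"
    by (auto simp: hawaiian_earring_def norm_divide intro!: bexI[of _ "1::nat"])
  then have 0: "(0, 0) \<in> cone_over hawaiian_earring"
    unfolding cone_over_def by (intro image_eqI[of _ _ "(0, 0)"]) (auto simp: cone_map_def)
  then have "(0, 0) \<in> uminus ` cone_over hawaiian_earring"
    by (rule image_eqI[rotated]) simp
  with 0 have "(0, 0) \<in> cone_over hawaiian_earring \<inter> uminus ` cone_over hawaiian_earring"
    by (rule IntI)
  moreover have *: "x = (0, 0)" if x: "x \<in> cone_over hawaiian_earring" "- x \<in> cone_over hawaiian_earring" for x
  proof -
    obtain z s where 1: "z \<in> hawaiian_earring" "s \<in> {0..1}" "x = cone_map (z, s)"
      using x(1) unfolding cone_over_def by blast
    obtain w t where 2: "w \<in> hawaiian_earring" "t \<in> {0..1}" "- x = cone_map (w, t)"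
      using x(2) unfolding cone_over_def by blast
    have eq: "x = ((1 - s) *\<^sub>R z, s)" "- x = ((1 - t) *\<^sub>R w, t)"
      using 1(3) 2(3) by (simp_all only: cone_map_def prod.case)
    have "- s = t" using arg_cong[OF eq(1), of snd] arg_cong[OF eq(2), of snd] by simp
    then have st: "s = 0" "t = 0" using 1(2) 2(2) by simp_all
    have xz: "x = (z, 0)" using eq(1) st(1) by simp
    have "- fst x = w" using arg_cong[OF eq(2), of fst] st(2) by simp
    then have "- Re z = Re w" using xz by (metis fst_conv uminus_complex.sel(1))
    then have "\<not> (Re z > 0 \<and> Re w > 0)" by linarith
    then have "z = 0" using re[OF 1(1)] re[OF 2(1)] \<open>- Re z = Re w\<close> by fastforce
    then show ?thesis using xz by simp
  qed
  have "x = (0, 0)" if "x \<in> cone_over hawaiian_earring \<inter> uminus ` cone_over hawaiian_earring" for x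
  proof (rule *)
    show "x \<in> cone_over hawaiian_earring" using that by (rule IntD1)
    from that obtain y where "y \<in> cone_over hawaiian_earring" "x = - y" by (elim IntE imageE)
    then show "- x \<in> cone_over hawaiian_earring" by (simp only: minus_minus)
  qed
  ultimately show ?thesis by blast
qed

datatype 'g letter = Gen 'g | Inv 'g

text \<open>The word \<open>[u\<^sub>0,v\<^sub>0][u\<^sub>1,v\<^sub>1]\<dots>\<close> with \<open>[u,v] = u\<^sup>-\<^sup>1v\<^sup>-\<^sup>1uv\<close>. Positions are numbered from \<open>0\<close>.\<close>

definition commutator_word :: "(nat \<Rightarrow> 'g \<times> 'g) \<Rightarrow> nat \<Rightarrow> 'g letter" where
  "commutator_word c i =
     (case c (i div 4) of (u, v) \<Rightarrow> [Inv u, Inv v, Gen u, Gen v] ! (i mod 4))"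

text \<open>Below, \<open>\<rho>\<close> assigns to each generator a loop at the base point \<open>x0\<close>.\<close>

fun letter_loop :: "('g \<Rightarrow> real \<Rightarrow> 'a::topological_space) \<Rightarrow> 'g letter \<Rightarrow> real \<Rightarrow> 'a" where
  "letter_loop \<rho> (Gen g) = \<rho> g"
| "letter_loop \<rho> (Inv g) = reversepath (\<rho> g)"

text \<open>The open intervals \<open>]a i, b i[\<close> are nonempty, disjoint, contained in \<open>]0, 1[\<close>, and ordered
  like \<open>\<nat>\<close>.\<close>

definition ordered_intervals :: "(nat \<Rightarrow> real) \<Rightarrow> (nat \<Rightarrow> real) \<Rightarrow> bool" where
  "ordered_intervals a b \<longleftrightarrow> (\<forall>i. 0 \<le> a i \<and> a i < b i \<and> b i \<le> a (Suc i) \<and> b i \<le> 1)"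

definition traverses ::
  "('g \<Rightarrow> real \<Rightarrow> 'a::topological_space) \<Rightarrow> 'a \<Rightarrow> (nat \<Rightarrow> 'g letter) \<Rightarrow>
   (nat \<Rightarrow> real) \<Rightarrow> (nat \<Rightarrow> real) \<Rightarrow> (real \<Rightarrow> 'a) \<Rightarrow> bool" where
  "traverses \<rho> x0 w a b f \<longleftrightarrow>
     (\<forall>i. \<forall>t\<in>{a i<..<b i}. f t = letter_loop \<rho> (w i) ((t - a i) / (b i - a i))) \<and>
     (\<forall>t\<in>{0..1} - (\<Union>i. {a i<..<b i}). f t = x0)"

text \<open>The homology class of a loop \<open>f\<close>, viewed as a singular 1-cycle by identifying the standard
  1-simplex with \<open>[0,1]\<close> through its second barycentric coordinate; this is the image of the homotopy
  class of \<open>f\<close> under the canonical map from \<open>\<pi>\<^sub>1\<close> to \<open>H\<^sub>1\<close>.\<close>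

definition loop_class :: "'a topology \<Rightarrow> (real \<Rightarrow> 'a) \<Rightarrow> 'a chain set" where
  "loop_class X f =
     homologous_rel_set 1 X {} (frag_of (restrict (\<lambda>x. f (x 1)) (standard_simplex 1)))"

lemma loop_class_in_homology_group:
  assumes "pathin X f" "f 0 = f 1"
  shows "loop_class X f \<in> carrier (homology_group 1 X)"
proof -
  let ?s = "restrict (\<lambda>x. f (x 1)) (standard_simplex 1)"
  have "continuous_map (subtopology (powertop_real UNIV) (standard_simplex 1)) (top_of_set {0..1}) (\<lambda>x. x 1)"
    unfolding continuous_map_in_subtopology
    by (auto simp: standard_simplex_def intro!: continuous_map_from_subtopology continuous_map_product_projection)
  then have "continuous_map (subtopology (powertop_real UNIV) (standard_simplex 1)) X (f \<circ> (\<lambda>x. x 1))"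
    using assms(1) continuous_map_compose unfolding pathin_def by blast
  then have "continuous_map (subtopology (powertop_real UNIV) (standard_simplex 1)) X ?s"
    by (rule continuous_map_eq) auto
  then have s: "singular_simplex 1 X ?s"
    by (simp add: singular_simplex_def)
  have "singular_face 1 0 ?s = singular_face 1 1 ?s"
  proof
    fix x
    show "singular_face 1 0 ?s x = singular_face 1 1 ?s x"
    proof (cases "x \<in> standard_simplex 0")
      case True
      have face: "singular_face 1 k ?s x = f (simplical_face k x 1)" if "k \<le> 1" for k
      proof -
        have "simplical_face k x \<in> standard_simplex 1"
          by (rule simplical_face_in_standard_simplex) (use True that in simp_all)
        then show ?thesis using True
          unfolding singular_face_def diff_self_eq_0 One_nat_def[symmetric] restrict_apply comp_def
          by (simp only: if_True)
      qed
      have "x 0 = 1" using True by (simp add: standard_simplex_def)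
      then have "simplical_face 0 x 1 = 1" "simplical_face 1 x 1 = 0"
        by (simp_all add: simplical_face_def)
      then show ?thesis using assms(2) face[of 0] face[of 1] by (simp only: le_numeral_extra order.refl zero_le_one)
    qed (simp only: singular_face_def diff_self_eq_0 One_nat_def[symmetric] restrict_apply if_False)
  qed
  then have "chain_boundary 1 (frag_of ?s) = 0"
    by (simp add: chain_boundary_of)
  then have "singular_relcycle 1 X {} (frag_of ?s)"
    using s by (simp add: singular_cycle singular_chain_of)
  then show ?thesis
    using carrier_relative_homology_group[of 1 X "{}"] unfolding loop_class_def by auto
qed

definition represents_class ::
  "'a::topological_space topology \<Rightarrow> ('g \<Rightarrow> real \<Rightarrow> 'a) \<Rightarrow> 'a \<Rightarrow> (nat \<Rightarrow> 'g letter) \<Rightarrow> 'a chain set \<Rightarrow> bool"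
  where
  "represents_class X \<rho> x0 w c \<longleftrightarrow>
     c \<in> carrier (homology_group 1 X) \<and>
     (\<exists>a b f. ordered_intervals a b \<and> traverses \<rho> x0 w a b f \<and> pathin X f \<and> c = loop_class X f)"

text \<open>A word defines an element of \<open>H\<^sub>1\<close> if each letter occurs in it only finitely often; the second
  conjunct says that its class is independent of the choice of the intervals.\<close>

definition defines_element ::
  "'a::topological_space topology \<Rightarrow> ('g \<Rightarrow> real \<Rightarrow> 'a) \<Rightarrow> 'a \<Rightarrow> (nat \<Rightarrow> 'g letter) \<Rightarrow> bool" where
  "defines_element X \<rho> x0 w \<longleftrightarrow>
     (\<forall>l. finite {i. w i = l}) \<and> (\<exists>!c. represents_class X \<rho> x0 w c)"

definition word_class ::
  "'a::topological_space topology \<Rightarrow> ('g \<Rightarrow> real \<Rightarrow> 'a) \<Rightarrow> 'a \<Rightarrow> (nat \<Rightarrow> 'g letter) \<Rightarrow> 'a chain set" where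
  "word_class X \<rho> x0 w = (THE c. represents_class X \<rho> x0 w c)"

datatype gen = P nat | Q nat

fun griffiths_loop :: "gen \<Rightarrow> real \<Rightarrow> complex \<times> real" where
  "griffiths_loop (P n) t = (circle_loop n t, 0)"
| "griffiths_loop (Q n) t = (- circle_loop n t, 0)"

text \<open>The words \<open>[p\<^bsub>k(1)\<^esub>,p\<^bsub>k(2)\<^esub>][p\<^bsub>k(3)\<^esub>,p\<^bsub>k(4)\<^esub>]\<dots>\<close> (where \<open>n\<close> stands for \<open>p\<^sub>n\<close>) and
  \<open>[p\<^bsub>k(1)\<^esub>,q\<^bsub>k(1)\<^esub>][p\<^bsub>k(2)\<^esub>,q\<^bsub>k(2)\<^esub>]\<dots>\<close>\<close>

definition pp_word :: "(nat \<Rightarrow> nat) \<Rightarrow> nat \<Rightarrow> nat letter" where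
  "pp_word k = commutator_word (\<lambda>m. (k (2 * m + 1), k (2 * m + 2)))"

definition pq_word :: "(nat \<Rightarrow> nat) \<Rightarrow> nat \<Rightarrow> gen letter" where
  "pq_word k = commutator_word (\<lambda>m. (P (k (m + 1)), Q (k (m + 1))))"

end

theory Submission
  imports Defs
begin

text \<open>Every loop considered here is an infinite product of commutators, so the winding numbers around the
  circles do not detect it, and a second-order invariant is required. For a path
  \<open>\<gamma>\<close> and two circle-valued maps \<open>\<alpha>\<close>, \<open>\<beta>\<close>, lift \<open>\<alpha> \<circ> \<gamma>\<close> and \<open>\<beta> \<circ> \<gamma>\<close> to real functions \<open>x\<close> and \<open>y\<close>
  and consider the iterated integral \<open>\<integral> (x - x(0)) dy\<close>. It makes sense for merely continuous paths
  and is invariant under homotopy as soon as at every point \<open>\<alpha> = 1\<close> or \<open>\<beta> = 1\<close>: the pair \<open>(x, y)\<close>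
  then moves on the grid of points with an integral coordinate, a one-dimensional space, on which the
  form \<open>x dy\<close> is closed.

  For families \<open>\<alpha>\<^sub>m\<close>, \<open>\<beta>\<^sub>n\<close> of such maps the integrals of a path form an infinite matrix
  \<open>M(\<gamma>)\<close>. Concatenation satisfies Chen's identity
  \<open>M\<^sub>m\<^sub>n(\<gamma>\<delta>) = M\<^sub>m\<^sub>n(\<gamma>) + M\<^sub>m\<^sub>n(\<delta>) + \<Delta>x\<^sub>m(\<gamma>) \<Delta>y\<^sub>n(\<delta>)\<close>, whose last term is a matrix of rank one. So the
  boundary of a singular 2-simplex has a matrix of rank at most one, and the matrix of a 1-cycle is
  an invariant of its homology class modulo matrices of finite rank
  (\<open>homologous_area_finite_rank\<close>).

  If the maps are the angles on the circles that occur in the \<open>m\<close>-th commutator of a word, the loop of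
  the word has the identity matrix (\<open>simplex_area_commutator_word\<close>), because a commutator contributes
  \<open>1\<close> exactly where both of its own circles are measured. The loop of a word that avoids almost all of
  these circles has a matrix with only finitely many nonzero rows. The identity matrix stays of
  infinite rank when finitely many rows and columns are removed
  (\<open>identity_matrix_not_finite_rank\<close>), so the two loops are not homologous
  (\<open>area_separates_loops\<close>). It remains to take continuum many sequences with almost disjoint ranges:
  \<open>prefix_code S\<close> lists codes of the initial segments of a set \<open>S\<close> of natural numbers.

  On the Hawaiian Earring the angle of the \<open>n\<close>-th circle extends continuously by \<open>1\<close> to the other
  circles. On Griffiths' space the angles are undefined at the two apexes. Excision removes small
  neighbourhoods of the apexes, at the price of chains in the remaining parts of the tips, and there
  the invariant vanishes, since a connected part of a tip sees only one of the two Earrings.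

  That a word determines a class rests on a reparametrisation: every loop that traverses the word is
  the loop on the dyadic intervals composed with a monotone self-map of \<open>[0,1]\<close> that fixes the end
  points.\<close>

section \<open>Circle-valued maps and the area of a path\<close>

lemma cis_2pi_eq_1_iff: "cis (2 * pi * x) = 1 \<longleftrightarrow> x \<in> \<int>"
proof
  assume "cis (2 * pi * x) = 1"
  then have "exp (\<i> * of_real (2 * pi * x)) = 1" by (simp add: cis_conv_exp)
  then obtain n :: int where "2 * pi * x = real_of_int (2 * n) * pi"
    by (auto simp: exp_eq_1)
  then have "x = of_int n" by simp
  then show "x \<in> \<int>" by simp
qed simp

lemma cis_2pi_eq_iff: "cis (2 * pi * x) = cis (2 * pi * y) \<longleftrightarrow> x - y \<in> \<int>"
proof -
  have "cis (2 * pi * x) = cis (2 * pi * (x - y)) * cis (2 * pi * y)"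
    by (simp add: cis_mult algebra_simps)
  then have "cis (2 * pi * x) = cis (2 * pi * y) \<longleftrightarrow> cis (2 * pi * (x - y)) = 1"
    by (metis cis_neq_zero mult_cancel_right1)
  then show ?thesis by (simp only: cis_2pi_eq_1_iff)
qed

text \<open>Two real lifts of one circle-valued map differ by such a function.\<close>

lemma integer_valued_constant:
  fixes h :: "'b::topological_space \<Rightarrow> real"
  assumes "connected C" "continuous_on C h" "\<And>z. z \<in> C \<Longrightarrow> h z \<in> \<int>"
  shows "\<exists>c\<in>\<int>. \<forall>z\<in>C. h z = c"
proof (cases "C = {}")
  case False
  have "h constant_on C"
  proof (rule continuous_discrete_range_constant[OF assms(1,2)])
    fix z assume z: "z \<in> C"
    have "1 \<le> norm (h w - h z)" if "w \<in> C" "h w \<noteq> h z" for w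
    proof -
      have "h w - h z \<in> \<int>" using assms(3) that z by simp
      then show ?thesis using that Ints_nonzero_abs_ge1 by force
    qed
    then show "\<exists>e>0. \<forall>w. w \<in> C \<and> h w \<noteq> h z \<longrightarrow> e \<le> norm (h w - h z)"
      using zero_less_one by blast
  qed
  then obtain c where c: "\<And>z. z \<in> C \<Longrightarrow> h z = c" unfolding constant_on_def by auto
  moreover from False obtain z where "z \<in> C" by auto
  ultimately have "c \<in> \<int>" using assms(3)[of z] by simp
  then show ?thesis using c by auto
qed auto

lemma circle_valued_lift:
  fixes p :: "'b::real_normed_vector \<Rightarrow> complex"
  assumes "convex C" "continuous_on C p" "\<And>z. z \<in> C \<Longrightarrow> norm (p z) = 1"
  obtains x where "continuous_on C x" "\<And>z. z \<in> C \<Longrightarrow> p z = cis (2 * pi * x z)"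
proof -
  have "p z \<noteq> 0" if "z \<in> C" for z using assms(3)[OF that] by auto
  then obtain g where g: "continuous_on C g" "\<And>z. z \<in> C \<Longrightarrow> p z = exp (g z)"
    using continuous_logarithm_on_contractible[OF assms(2) convex_imp_contractible[OF assms(1)]] by blast
  show ?thesis
  proof
    show "continuous_on C (\<lambda>z. Im (g z) / (2 * pi))" using g(1) by (intro continuous_intros) auto
    fix z assume "z \<in> C"
    then have "p z = exp (g z)" "norm (p z) = 1" using g assms by auto
    then have "Re (g z) = 0" by simp
    then have "g z = \<i> * Im (g z)" by (simp add: complex_eq_iff)
    then show "p z = cis (2 * pi * (Im (g z) / (2 * pi)))"
      using \<open>p z = exp (g z)\<close> by (simp add: cis_conv_exp)
  qed
qed

text \<open>\<open>F\<close> plays the role of the primitive \<open>\<integral> x dy\<close> along \<open>C\<close>. On the grid of points with an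
  integral coordinate, the form \<open>x dy\<close> integrates to \<open>1\<close> around a cell, so its primitive is
  determined modulo \<open>1\<close> by the position: it is \<open>x y\<close> on the lines \<open>x \<in> \<int>\<close> and \<open>0\<close> on the lines
  \<open>y \<in> \<int>\<close>. A continuous real function with these residues is the primitive up to a constant, which
  defines the integral without any differentiability of the path.\<close>

definition area_lift ::
  "'b::topological_space set \<Rightarrow> ('b \<Rightarrow> complex) \<Rightarrow> ('b \<Rightarrow> complex) \<Rightarrow>
   ('b \<Rightarrow> real) \<Rightarrow> ('b \<Rightarrow> real) \<Rightarrow> ('b \<Rightarrow> real) \<Rightarrow> bool" where
  "area_lift C p q x y F \<longleftrightarrow> continuous_on C x \<and> continuous_on C y \<and> continuous_on C F \<and>
     (\<forall>z\<in>C. p z = cis (2 * pi * x z) \<and> q z = cis (2 * pi * y z) \<and> (x z \<in> \<int> \<or> y z \<in> \<int>) \<and>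
       (x z \<in> \<int> \<longrightarrow> F z - x z * y z \<in> \<int>) \<and> (y z \<in> \<int> \<longrightarrow> F z \<in> \<int>))"

text \<open>The prescribed residues fit together to one continuous circle-valued map \<open>E\<close>: on the closed sets
  \<open>{q = 1}\<close> and \<open>{p = 1}\<close> it is given by different formulas, which agree at the grid points with two
  integral coordinates. Its lift is \<open>F\<close>.\<close>

lemma area_lift_exists:
  fixes p q :: "'b::real_normed_vector \<Rightarrow> complex"
  assumes C: "convex C"
    and x: "continuous_on C x" "\<And>z. z \<in> C \<Longrightarrow> p z = cis (2 * pi * x z)"
    and y: "continuous_on C y" "\<And>z. z \<in> C \<Longrightarrow> q z = cis (2 * pi * y z)"
    and wedge: "\<And>z. z \<in> C \<Longrightarrow> p z = 1 \<or> q z = 1"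
  shows "\<exists>F. area_lift C p q x y F"
proof -
  have p: "continuous_on C p" and q: "continuous_on C q"
    using x y by (auto intro!: continuous_intros cong: continuous_on_cong)
  define E where "E z = (if q z = 1 then 1 else cis (2 * pi * (x z * y z)))" for z
  have xy: "cis (2 * pi * (x z * y z)) = 1" if "z \<in> C" "p z = 1" "q z = 1" for z
    using that x(2)[of z] y(2)[of z] by (simp add: cis_2pi_eq_1_iff)
  have U: "{z \<in> C. q z = 1} \<union> {z \<in> C. p z = 1} = C" using wedge by blast
  have "continuous_on ({z \<in> C. q z = 1} \<union> {z \<in> C. p z = 1}) E"
    unfolding E_def
  proof (rule continuous_on_cases_local)
    show "continuous_on {z \<in> C. p z = 1} (\<lambda>z. cis (2 * pi * (x z * y z)))"
      using x(1) y(1) by (intro continuous_intros) (auto elim: continuous_on_subset)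
  qed (use xy p(1) q(1) in \<open>auto simp: U continuous_closedin_preimage_constant\<close>)
  then have "continuous_on C E" by (simp only: U)
  moreover have "norm (E z) = 1" for z by (simp add: E_def)
  ultimately obtain F where F: "continuous_on C F" "\<And>z. z \<in> C \<Longrightarrow> E z = cis (2 * pi * F z)"
    using circle_valued_lift[OF C] by blast
  have "area_lift C p q x y F"
    unfolding area_lift_def
  proof (intro conjI ballI impI)
    fix z assume z: "z \<in> C"
    show "x z \<in> \<int> \<or> y z \<in> \<int>"
      using wedge[OF z] x(2)[OF z] y(2)[OF z] by (simp add: cis_2pi_eq_1_iff)
    show "F z - x z * y z \<in> \<int>" if "x z \<in> \<int>"
    proof -
      have "p z = 1" using that x(2)[OF z] by simp
      then have "E z = cis (2 * pi * (x z * y z))" using xy[OF z] by (simp add: E_def)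
      then show ?thesis using F(2)[OF z] cis_2pi_eq_iff by simp
    qed
    show "F z \<in> \<int>" if "y z \<in> \<int>"
      using that y(2)[OF z] F(2)[OF z] cis_2pi_eq_1_iff[of "F z"] by (simp add: E_def)
  qed (use x y F in auto)
  then show ?thesis by blast
qed

lemma area_lift_compose:
  assumes "area_lift C p q x y F" "continuous_on D \<phi>" "\<phi> ` D \<subseteq> C"
    "\<And>t. t \<in> D \<Longrightarrow> p' t = p (\<phi> t)" "\<And>t. t \<in> D \<Longrightarrow> q' t = q (\<phi> t)"
  shows "area_lift D p' q' (x \<circ> \<phi>) (y \<circ> \<phi>) (F \<circ> \<phi>)"
proof -
  have "\<phi> t \<in> C" if "t \<in> D" for t using assms(3) that by blast
  moreover have "continuous_on D (h \<circ> \<phi>)" if "continuous_on C h" for h :: "_ \<Rightarrow> real"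
    using assms(2,3) that continuous_on_compose continuous_on_subset by blast
  ultimately show ?thesis using assms(1) unfolding area_lift_def by (simp add: assms(4,5))
qed

text \<open>The integral \<open>\<integral> (x - x(s)) dy\<close> from \<open>s\<close> to \<open>t\<close>. Subtracting the initial value of \<open>x\<close> makes it
  independent of the lift.\<close>

definition area_increment :: "('b \<Rightarrow> real) \<Rightarrow> ('b \<Rightarrow> real) \<Rightarrow> ('b \<Rightarrow> real) \<Rightarrow> 'b \<Rightarrow> 'b \<Rightarrow> real" where
  "area_increment x y F s t = F t - F s - x s * (y t - y s)"

text \<open>Other lifts are \<open>x + c\<close> and \<open>y + d\<close> with integral constants, and then \<open>F + c y\<close> has the residues
  required of the third function, so that it differs from the new one by a constant. The term \<open>c y\<close>
  is compensated by the change of the initial value of \<open>x\<close>.\<close>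

lemma area_increment_unique:
  assumes C: "connected C" "s \<in> C" "t \<in> C"
    and 1: "area_lift C p q x y F" and 2: "area_lift C p q x' y' F'"
  shows "area_increment x y F s t = area_increment x' y' F' s t"
proof -
  note L = 1[unfolded area_lift_def] 2[unfolded area_lift_def]
  have cont: "continuous_on C x" "continuous_on C y" "continuous_on C F"
    "continuous_on C x'" "continuous_on C y'" "continuous_on C F'"
    using L by blast+
  have "continuous_on C (\<lambda>z. x' z - x z)" by (intro continuous_intros cont)
  moreover have "x' z - x z \<in> \<int>" if "z \<in> C" for z
    using L that cis_2pi_eq_iff by metis
  ultimately obtain c where c: "c \<in> \<int>" "\<And>z. z \<in> C \<Longrightarrow> x' z - x z = c"
    using integer_valued_constant[OF C(1), of "\<lambda>z. x' z - x z"] by auto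
  have "continuous_on C (\<lambda>z. y' z - y z)" by (intro continuous_intros cont)
  moreover have "y' z - y z \<in> \<int>" if "z \<in> C" for z
    using L that cis_2pi_eq_iff by metis
  ultimately obtain d where d: "d \<in> \<int>" "\<And>z. z \<in> C \<Longrightarrow> y' z - y z = d"
    using integer_valued_constant[OF C(1), of "\<lambda>z. y' z - y z"] by auto
  have x': "x' z = x z + c" and y': "y' z = y z + d" if "z \<in> C" for z
    using c(2)[OF that] d(2)[OF that] by auto
  have "continuous_on C (\<lambda>z. F' z - F z - c * y z)" by (intro continuous_intros cont)
  moreover have "F' z - F z - c * y z \<in> \<int>" if z: "z \<in> C" for z
  proof -
    have "x z \<in> \<int> \<or> y z \<in> \<int>" using L z by blast
    then show ?thesis
    proof
      assume x: "x z \<in> \<int>"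
      then have "x' z \<in> \<int>" using x'[OF z] c(1) by simp
      then have "F z - x z * y z \<in> \<int>" "F' z - x' z * y' z \<in> \<int>"
        using L z x by blast+
      moreover have "x z * d \<in> \<int>" "c * d \<in> \<int>" using c(1) d(1) x by auto
      moreover have "F' z - F z - c * y z = (F' z - x' z * y' z) - (F z - x z * y z) + x z * d + c * d"
        using x'[OF z] y'[OF z] by (simp add: algebra_simps)
      ultimately show ?thesis by (simp only: Ints_add Ints_diff)
    next
      assume y: "y z \<in> \<int>"
      then have "y' z \<in> \<int>" using y'[OF z] d(1) by simp
      then have "F z \<in> \<int>" "F' z \<in> \<int>" using L z y by blast+
      then show ?thesis using c(1) y by (simp only: Ints_mult Ints_diff)
    qed
  qed
  ultimately obtain e where e: "\<And>z. z \<in> C \<Longrightarrow> F' z - F z - c * y z = e"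
    using integer_valued_constant[OF C(1), of "\<lambda>z. F' z - F z - c * y z"] by auto
  have F': "F' z = F z + c * y z + e" if "z \<in> C" for z using e[OF that] by simp
  show ?thesis
    unfolding area_increment_def x'[OF C(2)] y'[OF C(2)] y'[OF C(3)] F'[OF C(2)] F'[OF C(3)]
    by (simp add: algebra_simps)
qed

text \<open>By \<open>area_increment_unique\<close> the choice does not matter.\<close>

definition path_area :: "(real \<Rightarrow> complex) \<Rightarrow> (real \<Rightarrow> complex) \<Rightarrow> real" where
  "path_area p q =
     (SOME r. \<exists>x y F. area_lift {0..1} p q x y F \<and> r = area_increment x y F 0 1)"

lemma path_area_eq:
  assumes "area_lift {0..1} p q x y F"
  shows "path_area p q = area_increment x y F 0 1"
proof -
  have "\<exists>x y F. area_lift {0..1} p q x y F \<and> path_area p q = area_increment x y F 0 1"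
    unfolding path_area_def by (rule someI_ex) (use assms in blast)
  then obtain x' y' F' where *: "area_lift {0..1} p q x' y' F'"
    "path_area p q = area_increment x' y' F' 0 1" by auto
  show ?thesis
    unfolding *(2) by (rule area_increment_unique[OF _ _ _ *(1) assms]) auto
qed

section \<open>The invariant on singular simplices and chains\<close>

text \<open>Affine parametrisations of the standard simplices of dimension 1 and 2 by subsets of normed
  spaces, where lifts of circle-valued maps are available.\<close>

definition edge_point :: "real \<Rightarrow> nat \<Rightarrow> real" where
  "edge_point t = (\<lambda>i. if i = 0 then 1 - t else if i = 1 then t else 0)"

definition triangle_point :: "real \<times> real \<Rightarrow> nat \<Rightarrow> real" where
  "triangle_point = (\<lambda>(u, v) i. if i = 0 then 1 - u - v else if i = 1 then u else if i = 2 then v else 0)"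

definition unit_triangle :: "(real \<times> real) set" where
  "unit_triangle = {(u, v). 0 \<le> u \<and> 0 \<le> v \<and> u + v \<le> 1}"

lemma convex_triangle: "convex unit_triangle"
proof (rule convexI)
  fix z w :: "real \<times> real" and a b :: real
  assume "z \<in> unit_triangle" "w \<in> unit_triangle" "0 \<le> a" "0 \<le> b" "a + b = 1"
  moreover obtain z1 z2 w1 w2 where "z = (z1, z2)" "w = (w1, w2)" by (metis surj_pair)
  moreover have "a * z1 + b * w1 + (a * z2 + b * w2) = a * (z1 + z2) + b * (w1 + w2)"
    by (simp add: algebra_simps)
  moreover have "a * (z1 + z2) + b * (w1 + w2) \<le> a * 1 + b * 1" if "z1 + z2 \<le> 1" "w1 + w2 \<le> 1"
    using that \<open>0 \<le> a\<close> \<open>0 \<le> b\<close> by (intro add_mono mult_left_mono)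
  ultimately show "a *\<^sub>R z + b *\<^sub>R w \<in> unit_triangle"
    by (auto simp: unit_triangle_def)
qed

lemma edge_point_in: "t \<in> {0..1} \<Longrightarrow> edge_point t \<in> standard_simplex 1"
  by (auto simp: edge_point_def standard_simplex_def)

lemma triangle_point_in: "z \<in> unit_triangle \<Longrightarrow> triangle_point z \<in> standard_simplex 2"
  by (auto simp: triangle_point_def unit_triangle_def standard_simplex_def numeral_2_eq_2)

lemma face_edge_point:
  assumes "t \<in> {0..1}"
  shows "singular_face 2 0 \<sigma> (edge_point t) = \<sigma> (triangle_point (1 - t, t))"
    and "singular_face 2 1 \<sigma> (edge_point t) = \<sigma> (triangle_point (0, t))"
    and "singular_face 2 2 \<sigma> (edge_point t) = \<sigma> (triangle_point (t, 0))"
proof -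
  have *: "singular_face 2 k \<sigma> (edge_point t) = \<sigma> (simplical_face k (edge_point t))" for k
    using edge_point_in[OF assms] by (simp add: singular_face_def)
  have "simplical_face 0 (edge_point t) = triangle_point (1 - t, t)"
    "simplical_face 1 (edge_point t) = triangle_point (0, t)"
    "simplical_face 2 (edge_point t) = triangle_point (t, 0)"
    by (auto simp: simplical_face_def edge_point_def triangle_point_def fun_eq_iff)
  then show "singular_face 2 0 \<sigma> (edge_point t) = \<sigma> (triangle_point (1 - t, t))"
    and "singular_face 2 1 \<sigma> (edge_point t) = \<sigma> (triangle_point (0, t))"
    and "singular_face 2 2 \<sigma> (edge_point t) = \<sigma> (triangle_point (t, 0))"
    by (simp_all only: *)
qed

lemma continuous_map_simplex_point:
  assumes "singular_simplex p X \<sigma>" "continuous_map X euclidean \<alpha>"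
    and "\<And>i. continuous_on C (\<lambda>z. \<phi> z i)" "\<And>z. z \<in> C \<Longrightarrow> \<phi> z \<in> standard_simplex p"
  shows "continuous_on C (\<lambda>z. \<alpha> (\<sigma> (\<phi> z)))"
proof -
  have "continuous_map (top_of_set C) (powertop_real UNIV) \<phi>"
    unfolding continuous_map_componentwise by (auto simp: assms(3))
  then have "continuous_map (top_of_set C) (subtopology (powertop_real UNIV) (standard_simplex p)) \<phi>"
    using assms(4) by (auto simp: continuous_map_in_subtopology)
  then have "continuous_map (top_of_set C) euclidean (\<alpha> \<circ> (\<sigma> \<circ> \<phi>))"
    using assms(1,2) unfolding singular_simplex_def by (metis continuous_map_compose)
  then show ?thesis by (simp add: comp_def)
qed

lemma singular_simplex_in_topspace:
  assumes "singular_simplex p X \<sigma>" "z \<in> standard_simplex p"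
  shows "\<sigma> z \<in> topspace X"
proof -
  have "\<sigma> \<in> standard_simplex p \<rightarrow> topspace X"
    using assms(1) continuous_map_funspace unfolding singular_simplex_def
    by (metis topspace_standard_simplex)
  then show ?thesis using assms(2) by auto
qed

text \<open>The last condition says that each pair \<open>(\<alpha> m, \<beta> n)\<close> maps \<open>X\<close> to the one-point union of two
  circles inside the torus.\<close>

definition wedge_family :: "'a topology \<Rightarrow> (nat \<Rightarrow> 'a \<Rightarrow> complex) \<Rightarrow> (nat \<Rightarrow> 'a \<Rightarrow> complex) \<Rightarrow> bool" where
  "wedge_family X \<alpha> \<beta> \<longleftrightarrow>
     (\<forall>m. continuous_map X (top_of_set (sphere 0 1)) (\<alpha> m) \<and>
          continuous_map X (top_of_set (sphere 0 1)) (\<beta> m)) \<and>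
     (\<forall>m n. \<forall>x\<in>topspace X. \<alpha> m x = 1 \<or> \<beta> n x = 1)"

definition simplex_area :: "('a \<Rightarrow> complex) \<Rightarrow> ('a \<Rightarrow> complex) \<Rightarrow> ((nat \<Rightarrow> real) \<Rightarrow> 'a) \<Rightarrow> real" where
  "simplex_area \<alpha> \<beta> \<sigma> = path_area (\<lambda>t. \<alpha> (\<sigma> (edge_point t))) (\<lambda>t. \<beta> (\<sigma> (edge_point t)))"

lemma triangle_lift:
  assumes \<sigma>: "singular_simplex 2 X \<sigma>" and \<alpha>: "continuous_map X (top_of_set (sphere 0 1)) \<alpha>"
  shows "\<exists>x. continuous_on unit_triangle x \<and>
     (\<forall>z\<in>unit_triangle. \<alpha> (\<sigma> (triangle_point z)) = cis (2 * pi * x z))"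
proof -
  have "continuous_on unit_triangle (\<lambda>z. \<alpha> (\<sigma> (triangle_point z)))"
  proof (rule continuous_map_simplex_point[OF \<sigma>])
    show "continuous_map X euclidean \<alpha>" using \<alpha> by (simp add: continuous_map_in_subtopology)
    show "continuous_on unit_triangle (\<lambda>z. triangle_point z i)" for i
      unfolding triangle_point_def case_prod_unfold
      by (cases "i = 0"; cases "i = 1"; cases "i = 2") (auto intro!: continuous_intros)
  qed (rule triangle_point_in)
  moreover have "norm (\<alpha> (\<sigma> (triangle_point z))) = 1" if "z \<in> unit_triangle" for z
    using singular_simplex_in_topspace[OF \<sigma> triangle_point_in[OF that]] \<alpha>
    by (auto simp: continuous_map_in_subtopology)
  ultimately show ?thesis
    using circle_valued_lift[OF convex_triangle, of "\<lambda>z. \<alpha> (\<sigma> (triangle_point z))"] by metis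
qed

text \<open>Chen's identity for the three edges of a triangle. Since a triangle is convex, the lifts \<open>x\<close>,
  \<open>y\<close>, \<open>F\<close> exist on all of it, and the increments along the edges can be compared by plain algebra;
  the result is the increment of \<open>x\<close> on the first edge times that of \<open>y\<close> on the second, up to sign.\<close>

lemma simplex_area_boundary_rank_one:
  assumes \<sigma>: "singular_simplex 2 X \<sigma>" and W: "wedge_family X \<alpha> \<beta>"
  shows "\<exists>u v. \<forall>m n. simplex_area (\<alpha> m) (\<beta> n) (singular_face 2 0 \<sigma>)
      - simplex_area (\<alpha> m) (\<beta> n) (singular_face 2 1 \<sigma>)
      + simplex_area (\<alpha> m) (\<beta> n) (singular_face 2 2 \<sigma>) = u m * v n"
proof -
  have "\<forall>m. \<exists>x. continuous_on unit_triangle x \<and>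
     (\<forall>z\<in>unit_triangle. \<alpha> m (\<sigma> (triangle_point z)) = cis (2 * pi * x z))"
    using triangle_lift[OF \<sigma>] W unfolding wedge_family_def by blast
  from choice[OF this] obtain x where x: "\<And>m. continuous_on unit_triangle (x m)"
    "\<And>m z. z \<in> unit_triangle \<Longrightarrow> \<alpha> m (\<sigma> (triangle_point z)) = cis (2 * pi * x m z)" by metis
  have "\<forall>m. \<exists>y. continuous_on unit_triangle y \<and>
     (\<forall>z\<in>unit_triangle. \<beta> m (\<sigma> (triangle_point z)) = cis (2 * pi * y z))"
    using triangle_lift[OF \<sigma>] W unfolding wedge_family_def by blast
  from choice[OF this] obtain y where y: "\<And>m. continuous_on unit_triangle (y m)"
    "\<And>m z. z \<in> unit_triangle \<Longrightarrow> \<beta> m (\<sigma> (triangle_point z)) = cis (2 * pi * y m z)" by metis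
  have "simplex_area (\<alpha> m) (\<beta> n) (singular_face 2 0 \<sigma>)
      - simplex_area (\<alpha> m) (\<beta> n) (singular_face 2 1 \<sigma>)
      + simplex_area (\<alpha> m) (\<beta> n) (singular_face 2 2 \<sigma>)
      = (x m (0, 0) - x m (1, 0)) * (y n (0, 1) - y n (1, 0))" for m n
  proof -
    have wedge: "\<alpha> m (\<sigma> (triangle_point z)) = 1 \<or> \<beta> n (\<sigma> (triangle_point z)) = 1" if "z \<in> unit_triangle" for z
      using W singular_simplex_in_topspace[OF \<sigma> triangle_point_in[OF that]]
      unfolding wedge_family_def by metis
    obtain F where F: "area_lift unit_triangle (\<lambda>z. \<alpha> m (\<sigma> (triangle_point z)))
        (\<lambda>z. \<beta> n (\<sigma> (triangle_point z))) (x m) (y n) F"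
      using area_lift_exists[OF convex_triangle x(1) x(2) y(1) y(2) wedge] by auto
    have *: "simplex_area (\<alpha> m) (\<beta> n) (singular_face 2 k \<sigma>)
        = area_increment (x m) (y n) F (\<phi> 0) (\<phi> 1)"
      if "continuous_on {0..1} \<phi>" "\<phi> ` {0..1} \<subseteq> unit_triangle"
        "\<And>t. t \<in> {0..1} \<Longrightarrow> singular_face 2 k \<sigma> (edge_point t) = \<sigma> (triangle_point (\<phi> t))" for k \<phi>
    proof -
      have "area_lift {0..1} (\<lambda>t. \<alpha> m (singular_face 2 k \<sigma> (edge_point t)))
          (\<lambda>t. \<beta> n (singular_face 2 k \<sigma> (edge_point t))) (x m \<circ> \<phi>) (y n \<circ> \<phi>) (F \<circ> \<phi>)"
        by (rule area_lift_compose[OF F that(1,2)]) (simp_all add: that(3))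
      then show ?thesis
        unfolding simplex_area_def by (rule path_area_eq[THEN trans]) (simp add: area_increment_def)
    qed
    have 0: "simplex_area (\<alpha> m) (\<beta> n) (singular_face 2 0 \<sigma>)
        = area_increment (x m) (y n) F (1, 0) (0, 1)"
      by (subst *[of "\<lambda>t. (1 - t, t)"]) (auto intro!: continuous_intros simp: unit_triangle_def face_edge_point)
    have 1: "simplex_area (\<alpha> m) (\<beta> n) (singular_face 2 1 \<sigma>)
        = area_increment (x m) (y n) F (0, 0) (0, 1)"
      by (subst *[of "\<lambda>t. (0, t)"])
        (use face_edge_point(2) in \<open>auto intro!: continuous_intros simp: unit_triangle_def\<close>)
    have 2: "simplex_area (\<alpha> m) (\<beta> n) (singular_face 2 2 \<sigma>)
        = area_increment (x m) (y n) F (0, 0) (1, 0)"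
      by (subst *[of "\<lambda>t. (t, 0)"]) (auto intro!: continuous_intros simp: unit_triangle_def face_edge_point)
    show ?thesis unfolding 0 1 2 by (simp add: area_increment_def algebra_simps)
  qed
  then show ?thesis
    by - (rule exI[where x = "\<lambda>m. x m (0, 0) - x m (1, 0)"],
      rule exI[where x = "\<lambda>n. y n (0, 1) - y n (1, 0)"], intro allI)
qed

definition chain_sum :: "('b \<Rightarrow> real) \<Rightarrow> ('b \<Rightarrow>\<^sub>0 int) \<Rightarrow> real" where
  "chain_sum h c = (\<Sum>\<sigma>\<in>Poly_Mapping.keys c. of_int (Poly_Mapping.lookup c \<sigma>) * h \<sigma>)"

lemma chain_sum_superset:
  assumes "finite B" "Poly_Mapping.keys c \<subseteq> B"
  shows "chain_sum h c = (\<Sum>\<sigma>\<in>B. of_int (Poly_Mapping.lookup c \<sigma>) * h \<sigma>)"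
  unfolding chain_sum_def using assms by (intro sum.mono_neutral_left) (auto simp: in_keys_iff)

lemma chain_sum_add: "chain_sum h (c + d) = chain_sum h c + chain_sum h d"
proof -
  let ?B = "Poly_Mapping.keys c \<union> Poly_Mapping.keys d"
  have "chain_sum h e = (\<Sum>\<sigma>\<in>?B. of_int (Poly_Mapping.lookup e \<sigma>) * h \<sigma>)"
    if "Poly_Mapping.keys e \<subseteq> ?B" for e
    by (rule chain_sum_superset) (use that in auto)
  moreover have "Poly_Mapping.keys (c + d) \<subseteq> ?B" by (rule keys_add)
  ultimately show ?thesis by (simp add: lookup_add algebra_simps sum.distrib)
qed

lemma chain_sum_frag_cmul: "chain_sum h (frag_cmul k c) = of_int k * chain_sum h c"
proof -
  have "chain_sum h (frag_cmul k c)
      = (\<Sum>\<sigma>\<in>Poly_Mapping.keys c. of_int (Poly_Mapping.lookup (frag_cmul k c) \<sigma>) * h \<sigma>)"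
    by (rule chain_sum_superset) (auto simp: keys_cmul)
  then show ?thesis by (simp add: chain_sum_def sum_distrib_left algebra_simps)
qed

lemma chain_sum_frag_of: "chain_sum h (frag_of \<sigma>) = h \<sigma>"
  by (simp add: chain_sum_def)

lemma chain_sum_diff: "chain_sum h (c - d) = chain_sum h c - chain_sum h d"
  using chain_sum_add[of h "c - d" d] by simp

lemma chain_sum_sum: "chain_sum h (\<Sum>i\<in>I. f i) = (\<Sum>i\<in>I. chain_sum h (f i))"
  by (induction I rule: infinite_finite_induct) (simp_all add: chain_sum_add, simp_all add: chain_sum_def)

lemma chain_sum_chain_boundary_2:
  "chain_sum h (chain_boundary 2 d) =
     (\<Sum>\<sigma>\<in>Poly_Mapping.keys d. of_int (Poly_Mapping.lookup d \<sigma>) *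
        (h (singular_face 2 0 \<sigma>) - h (singular_face 2 1 \<sigma>) + h (singular_face 2 2 \<sigma>)))"
  by (simp add: chain_boundary_def frag_extend_def chain_sum_sum chain_sum_frag_cmul chain_sum_add
      chain_sum_frag_of numeral_2_eq_2 algebra_simps chain_sum_diff)

text \<open>Each simplex of a 2-chain that bounds the difference contributes a matrix of rank one. The set \<open>A\<close>
  accommodates relative homology, as needed after excision.\<close>

lemma homologous_area_finite_rank:
  fixes X :: "'a topology"
  assumes W: "wedge_family X \<alpha> \<beta>"
    and A: "\<And>\<sigma> m n. singular_simplex 1 (subtopology X A) \<sigma> \<Longrightarrow> simplex_area (\<alpha> m) (\<beta> n) \<sigma> = 0"
    and hom: "homologous_rel 1 X A c c'"
  shows "\<exists>(S :: ((nat \<Rightarrow> real) \<Rightarrow> 'a) set) u v. finite S \<and>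
    (\<forall>m n. chain_sum (simplex_area (\<alpha> m) (\<beta> n)) c - chain_sum (simplex_area (\<alpha> m) (\<beta> n)) c'
       = (\<Sum>s\<in>S. u s m * v s n))"
proof -
  obtain d e where d: "singular_chain 2 X d" and e: "singular_chain 1 (subtopology X A) e"
    and de: "chain_boundary 2 d + e = c - c'"
    using hom unfolding homologous_rel_def singular_relboundary by (auto simp: numeral_2_eq_2)
  have "\<forall>\<sigma>\<in>Poly_Mapping.keys d. \<exists>u v. \<forall>m n. simplex_area (\<alpha> m) (\<beta> n) (singular_face 2 0 \<sigma>)
      - simplex_area (\<alpha> m) (\<beta> n) (singular_face 2 1 \<sigma>)
      + simplex_area (\<alpha> m) (\<beta> n) (singular_face 2 2 \<sigma>) = u m * v n"
    using simplex_area_boundary_rank_one[OF _ W] d unfolding singular_chain_def by blast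
  from bchoice[OF this] obtain u where "\<forall>\<sigma>\<in>Poly_Mapping.keys d. \<exists>v. \<forall>m n.
      simplex_area (\<alpha> m) (\<beta> n) (singular_face 2 0 \<sigma>)
      - simplex_area (\<alpha> m) (\<beta> n) (singular_face 2 1 \<sigma>)
      + simplex_area (\<alpha> m) (\<beta> n) (singular_face 2 2 \<sigma>) = u \<sigma> m * v n" by blast
  from bchoice[OF this] obtain v where uv: "\<And>\<sigma> m n. \<sigma> \<in> Poly_Mapping.keys d \<Longrightarrow>
      simplex_area (\<alpha> m) (\<beta> n) (singular_face 2 0 \<sigma>)
      - simplex_area (\<alpha> m) (\<beta> n) (singular_face 2 1 \<sigma>)
      + simplex_area (\<alpha> m) (\<beta> n) (singular_face 2 2 \<sigma>) = u \<sigma> m * v \<sigma> n" by metis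
  have "chain_sum (simplex_area (\<alpha> m) (\<beta> n)) c - chain_sum (simplex_area (\<alpha> m) (\<beta> n)) c'
       = (\<Sum>\<sigma>\<in>Poly_Mapping.keys d. (of_int (Poly_Mapping.lookup d \<sigma>) * u \<sigma> m) * v \<sigma> n)"
    for m n
  proof -
    have "chain_sum (simplex_area (\<alpha> m) (\<beta> n)) e = 0"
      using e A unfolding chain_sum_def singular_chain_def by (intro sum.neutral) auto
    then have "chain_sum (simplex_area (\<alpha> m) (\<beta> n)) (c - c') =
        chain_sum (simplex_area (\<alpha> m) (\<beta> n)) (chain_boundary 2 d)"
      unfolding de[symmetric] chain_sum_add by simp
    also have "\<dots> = (\<Sum>\<sigma>\<in>Poly_Mapping.keys d. (of_int (Poly_Mapping.lookup d \<sigma>) * u \<sigma> m) * v \<sigma> n)"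
      unfolding chain_sum_chain_boundary_2 by (rule sum.cong) (simp_all only: uv mult.assoc)
    finally show ?thesis by (simp add: chain_sum_diff)
  qed
  then show ?thesis
    by - (rule exI[where x = "Poly_Mapping.keys d"],
      rule exI[where x = "\<lambda>\<sigma> m. of_int (Poly_Mapping.lookup d \<sigma>) * u \<sigma> m"], rule exI[where x = v],
      intro conjI finite_keys allI)
qed

text \<open>Finitely many homogeneous linear equations in infinitely many unknowns have a nontrivial solution
  of finite support. For the induction step, two solutions with disjoint supports are combined such
  that the new equation is satisfied as well.\<close>

lemma homogeneous_system_solution:
  fixes u :: "'s \<Rightarrow> nat \<Rightarrow> real"
  assumes "finite S" "infinite A"
  shows "\<exists>F l. finite F \<and> F \<noteq> {} \<and> F \<subseteq> A \<and> (\<exists>m\<in>F. l m \<noteq> 0) \<and> (\<forall>s\<in>S. (\<Sum>m\<in>F. l m * u s m) = 0)"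
  using assms
proof (induction S arbitrary: A rule: finite_induct)
  case empty
  then obtain a where "a \<in> A" using infinite_imp_nonempty by auto
  then show ?case by (intro exI[of _ "{a}"] exI[of _ "\<lambda>_. 1"]) auto
next
  case (insert s0 S)
  obtain F1 l1 where 1: "finite F1" "F1 \<subseteq> A" "\<exists>m\<in>F1. l1 m \<noteq> 0" "\<And>s. s \<in> S \<Longrightarrow> (\<Sum>m\<in>F1. l1 m * u s m) = 0"
    using insert.IH[OF insert.prems] by metis
  have "infinite (A - F1)" using insert.prems 1 by simp
  then obtain F2 l2 where 2: "finite F2" "F2 \<subseteq> A - F1" "\<exists>m\<in>F2. l2 m \<noteq> 0"
    "\<And>s. s \<in> S \<Longrightarrow> (\<Sum>m\<in>F2. l2 m * u s m) = 0"
    using insert.IH by metis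
  define a where "a = (\<Sum>m\<in>F1. l1 m * u s0 m)"
  define b where "b = (\<Sum>m\<in>F2. l2 m * u s0 m)"
  show ?case
  proof (cases "a = 0")
    case True
    then show ?thesis using 1 unfolding a_def by (intro exI[of _ F1] exI[of _ l1]) auto
  next
    case False
    define l where "l m = (if m \<in> F1 then b * l1 m else - a * l2 m)" for m
    have sum: "(\<Sum>m\<in>F1 \<union> F2. l m * u s m) = b * (\<Sum>m\<in>F1. l1 m * u s m) - a * (\<Sum>m\<in>F2. l2 m * u s m)" for s
    proof -
      have "(\<Sum>m\<in>F1 \<union> F2. l m * u s m) = (\<Sum>m\<in>F1. l m * u s m) + (\<Sum>m\<in>F2. l m * u s m)"
        using 1 2 by (intro sum.union_disjoint) auto
      also have "(\<Sum>m\<in>F1. l m * u s m) = b * (\<Sum>m\<in>F1. l1 m * u s m)"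
        by (auto simp: sum_distrib_left l_def intro!: sum.cong)
      also have "(\<Sum>m\<in>F2. l m * u s m) = - a * (\<Sum>m\<in>F2. l2 m * u s m)"
        unfolding sum_distrib_left using 2(2) by (intro sum.cong) (auto simp: l_def)
      finally show ?thesis by simp
    qed
    have "(\<Sum>m\<in>F1 \<union> F2. l m * u s m) = 0" if "s \<in> insert s0 S" for s
      using that 1(4) 2(4) unfolding sum by (auto simp: a_def b_def)
    moreover have "\<exists>m\<in>F1 \<union> F2. l m \<noteq> 0" using 2(2,3) False by (auto simp: l_def)
    ultimately show ?thesis using 1(1,2,3) 2(1,2)
      by (intro exI[of _ "F1 \<union> F2"] exI[of _ l]) auto
  qed
qed

text \<open>A vanishing combination of the rows of the left factor would be a vanishing combination of unit
  vectors.\<close>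

lemma identity_matrix_not_finite_rank:
  fixes u v :: "'s \<Rightarrow> nat \<Rightarrow> real"
  assumes "finite S"
    and id: "\<And>m n. m \<ge> N \<Longrightarrow> n \<ge> N \<Longrightarrow> (\<Sum>s\<in>S. u s m * v s n) = (if m = n then 1 else 0)"
  shows False
proof -
  obtain F l where F: "finite F" "F \<subseteq> {N..}" "\<exists>m\<in>F. l m \<noteq> 0" "\<And>s. s \<in> S \<Longrightarrow> (\<Sum>m\<in>F. l m * u s m) = 0"
    using homogeneous_system_solution[OF assms(1) infinite_Ici[of N], of u] by metis
  then obtain n where n: "n \<in> F" "l n \<noteq> 0" by blast
  have "l n = (\<Sum>m\<in>F. l m * (if m = n then 1 else 0))" using F(1) n(1) by (simp add: if_distrib cong: if_cong)
  also have "\<dots> = (\<Sum>m\<in>F. l m * (\<Sum>s\<in>S. u s m * v s n))"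
    using F(2) n(1) by (intro sum.cong) (auto simp: id subset_eq)
  also have "\<dots> = (\<Sum>s\<in>S. (\<Sum>m\<in>F. l m * u s m) * v s n)"
    by (simp add: sum_distrib_left sum_distrib_right mult.assoc) (rule sum.swap)
  also have "\<dots> = 0" by (simp add: F(4))
  finally show False using n by simp
qed

section \<open>The invariant of a loop that traverses a word\<close>

definition progress :: "(nat \<Rightarrow> real) \<Rightarrow> (nat \<Rightarrow> real) \<Rightarrow> nat \<Rightarrow> real \<Rightarrow> real" where
  "progress a b i t = max 0 (min 1 ((t - a i) / (b i - a i)))"

lemma progress_bounds: "0 \<le> progress a b i t" "progress a b i t \<le> 1"
  by (auto simp: progress_def)

lemma continuous_on_progress: "continuous_on C (progress a b i)"
proof (cases "b i = a i")
  case False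
  then show ?thesis unfolding progress_def[abs_def] by (intro continuous_intros) auto
qed (simp add: progress_def[abs_def])

lemma ordered_intervals_le:
  assumes "ordered_intervals a b" "i < j"
  shows "b i \<le> a j"
  using assms(2)
proof (induction j)
  case (Suc j)
  have j: "a j < b j" "b j \<le> a (Suc j)" using assms(1) unfolding ordered_intervals_def by blast+
  show ?case
  proof (cases "i = j")
    case False
    then have "b i \<le> a j" using Suc by simp
    then show ?thesis using j by linarith
  qed (use j in simp)
qed simp

lemma progress_eq_0:
  assumes "ordered_intervals a b" "t \<le> a i"
  shows "progress a b i t = 0"
proof -
  have "a i < b i" using assms unfolding ordered_intervals_def by blast
  then have "(t - a i) / (b i - a i) \<le> 0" using assms(2) by (intro divide_nonpos_pos) auto
  then show ?thesis unfolding progress_def by linarith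
qed

lemma progress_eq_1:
  assumes "ordered_intervals a b" "b i \<le> t"
  shows "progress a b i t = 1"
proof -
  have "a i < b i" using assms unfolding ordered_intervals_def by blast
  then have "1 \<le> (t - a i) / (b i - a i)" using assms(2) by (simp add: pos_le_divide_eq)
  then show ?thesis unfolding progress_def by linarith
qed

lemma progress_inside:
  assumes "ordered_intervals a b" "t \<in> {a i<..<b i}"
  shows "progress a b i t = (t - a i) / (b i - a i)" "0 < progress a b i t" "progress a b i t < 1"
proof -
  have "0 < (t - a i) / (b i - a i)" "(t - a i) / (b i - a i) < 1"
    using assms(2) by (auto simp: pos_divide_less_eq)
  then show "progress a b i t = (t - a i) / (b i - a i)" "0 < progress a b i t" "progress a b i t < 1"
    unfolding progress_def by linarith+
qed

lemma progress_outside: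
  assumes "ordered_intervals a b" "t \<notin> {a i<..<b i}"
  shows "progress a b i t = 0 \<or> progress a b i t = 1"
  using progress_eq_0[OF assms(1), of t i] progress_eq_1[OF assms(1), of i t] assms(2)
  by (meson greaterThanLessThan_iff not_le)

text \<open>A letter is started only after all earlier ones are finished. All statements about the shape of a
  loop that traverses a word are derived from this.\<close>

lemma progress_consecutive:
  assumes "ordered_intervals a b" "i < j" "progress a b j t \<noteq> 0"
  shows "progress a b i t = 1"
proof -
  have "a j < t" using progress_eq_0[OF assms(1)] assms(3) by (meson not_le)
  then show ?thesis
    using ordered_intervals_le[OF assms(1,2)] progress_eq_1[OF assms(1)] by simp
qed

lemma progress_other:
  assumes "ordered_intervals a b" "t \<in> {a i<..<b i}"
  shows "j < i \<Longrightarrow> progress a b j t = 1" "i < j \<Longrightarrow> progress a b j t = 0"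
  using progress_inside(2,3)[OF assms] progress_consecutive[OF assms(1), of j i t]
    progress_consecutive[OF assms(1), of i j t] by force+

fun letter_sign :: "'g \<Rightarrow> 'g letter \<Rightarrow> real" where
  "letter_sign u (Gen g) = (if g = u then 1 else 0)"
| "letter_sign u (Inv g) = (if g = u then -1 else 0)"

lemma letter_sign_Ints: "letter_sign u l \<in> \<int>"
  by (cases l) auto

text \<open>If the generator \<open>u\<close> occurs only at the positions in the finite set \<open>B\<close>, this is an explicit lift
  of the angle of \<open>u\<close> along the loop of the word.\<close>

lemma angle_along_word:
  assumes ab: "ordered_intervals a b" and f: "traverses \<rho> x0 w a b f"
    and B: "finite B" "\<And>i. i \<notin> B \<Longrightarrow> letter_sign u (w i) = 0"
    and x0: "\<alpha> x0 = 1"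
    and \<alpha>: "\<And>g s. s \<in> {0..1} \<Longrightarrow> \<alpha> (\<rho> g s) = (if g = u then cis (2 * pi * s) else 1)"
    and t: "t \<in> {0..1}"
  shows "\<alpha> (f t) = cis (2 * pi * (\<Sum>i\<in>B. letter_sign u (w i) * progress a b i t))"
proof (cases "\<exists>i. t \<in> {a i<..<b i}")
  case True
  then obtain i where i: "t \<in> {a i<..<b i}" by blast
  let ?s = "progress a b i t"
  have s: "?s \<in> {0..1}" "1 - ?s \<in> {0..1}" using progress_bounds[of a b i t] by auto
  have "f t = letter_loop \<rho> (w i) ?s"
    using f i progress_inside(1)[OF ab i] unfolding traverses_def by simp
  moreover have "\<alpha> (letter_loop \<rho> l ?s) = cis (2 * pi * (letter_sign u l * ?s))" for l
  proof (cases l)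
    case (Inv g)
    have "cis (2 * pi * (1 - ?s)) = cis (2 * pi * (- ?s))"
      by (subst cis_2pi_eq_iff) simp
    then show ?thesis using \<alpha>[OF s(2)] Inv by (simp add: reversepath_def)
  qed (use \<alpha>[OF s(1)] in simp)
  \<comment> \<open>All other letters are finished or not yet started and change the lift by integers.\<close>
  moreover have "(\<Sum>j\<in>B. letter_sign u (w j) * progress a b j t) - letter_sign u (w i) * ?s \<in> \<int>"
  proof -
    have "(\<Sum>j\<in>insert i B. letter_sign u (w j) * progress a b j t) =
        (\<Sum>j\<in>B. letter_sign u (w j) * progress a b j t)"
      using B by (intro sum.mono_neutral_right) auto
    then have "(\<Sum>j\<in>B. letter_sign u (w j) * progress a b j t) - letter_sign u (w i) * ?s =
        (\<Sum>j\<in>insert i B - {i}. letter_sign u (w j) * progress a b j t)"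
      using B(1) by (simp add: sum.remove[of "insert i B" i])
    also have "\<dots> \<in> \<int>"
    proof (intro Ints_sum Ints_mult letter_sign_Ints)
      fix j assume "j \<in> insert i B - {i}"
      then show "progress a b j t \<in> \<int>" using progress_other[OF ab i, of j] by (cases "j < i") auto
    qed
    finally show ?thesis .
  qed
  ultimately show ?thesis using cis_2pi_eq_iff by metis
next
  case False
  then have "f t = x0" using f t unfolding traverses_def by auto
  moreover have "(\<Sum>j\<in>B. letter_sign u (w j) * progress a b j t) \<in> \<int>"
  proof (intro Ints_sum Ints_mult letter_sign_Ints)
    fix j show "progress a b j t \<in> \<int>" using progress_outside[OF ab, of t j] False by auto
  qed
  ultimately show ?thesis using x0 cis_2pi_eq_1_iff by metis
qed

abbreviation loop_simplex :: "(real \<Rightarrow> 'a) \<Rightarrow> (nat \<Rightarrow> real) \<Rightarrow> 'a" where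
  "loop_simplex f \<equiv> restrict (\<lambda>x. f (x 1)) (standard_simplex 1)"

lemma loop_simplex_edge_point: "t \<in> {0..1} \<Longrightarrow> loop_simplex f (edge_point t) = f t"
  using edge_point_in[of t] by (simp add: edge_point_def)

lemma commutator_word_nth:
  "commutator_word c (4 * m) = Inv (fst (c m))"
  "commutator_word c (4 * m + 1) = Inv (snd (c m))"
  "commutator_word c (4 * m + 2) = Gen (fst (c m))"
  "commutator_word c (4 * m + 3) = Gen (snd (c m))"
proof -
  have "commutator_word c (4 * m + r) = [Inv (fst (c m)), Inv (snd (c m)), Gen (fst (c m)), Gen (snd (c m))] ! r"
    if "r < 4" for r
    using that by (simp add: commutator_word_def case_prod_unfold)
  from this[of 0] this[of 1] this[of 2] this[of 3] show
    "commutator_word c (4 * m) = Inv (fst (c m))"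
    "commutator_word c (4 * m + 1) = Inv (snd (c m))"
    "commutator_word c (4 * m + 2) = Gen (fst (c m))"
    "commutator_word c (4 * m + 3) = Gen (snd (c m))"
    by simp_all
qed

lemma commutator_word_position:
  fixes i :: nat
  obtains m where "i = 4 * m" | m where "i = 4 * m + 1" | m where "i = 4 * m + 2" | m where "i = 4 * m + 3"
proof -
  have "i = 4 * (i div 4) \<or> i = 4 * (i div 4) + 1 \<or> i = 4 * (i div 4) + 2 \<or> i = 4 * (i div 4) + 3"
    by presburger
  then show ?thesis using that by metis
qed

lemma letter_sign_commutator_word_fst:
  assumes "\<And>k. fst (c k) = u \<longleftrightarrow> k = m" "\<And>k. snd (c k) \<noteq> u"
  shows "letter_sign u (commutator_word c i) = (if i = 4 * m then -1 else if i = 4 * m + 2 then 1 else 0)"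
proof (cases i rule: commutator_word_position)
  case (1 k)
  then have "(i = 4 * m) = (k = m)" "(i = 4 * m + 2) = False" by presburger+
  then show ?thesis by (simp only: 1 commutator_word_nth letter_sign.simps assms if_False)
next
  case (2 k)
  then have "(i = 4 * m) = False" "(i = 4 * m + 2) = False" by presburger+
  then show ?thesis by (simp only: 2 commutator_word_nth letter_sign.simps assms if_False)
next
  case (3 k)
  then have "(i = 4 * m) = False" "(i = 4 * m + 2) = (k = m)" by presburger+
  then show ?thesis by (simp only: 3 commutator_word_nth letter_sign.simps assms if_False)
next
  case (4 k)
  then have "(i = 4 * m) = False" "(i = 4 * m + 2) = False" by presburger+
  then show ?thesis by (simp only: 4 commutator_word_nth letter_sign.simps assms if_False)
qed

lemma letter_sign_commutator_word_snd:
  assumes "\<And>k. snd (c k) = u \<longleftrightarrow> k = m" "\<And>k. fst (c k) \<noteq> u"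
  shows "letter_sign u (commutator_word c i) = (if i = 4 * m + 1 then -1 else if i = 4 * m + 3 then 1 else 0)"
proof (cases i rule: commutator_word_position)
  case (1 k)
  then have "(i = 4 * m + 1) = False" "(i = 4 * m + 3) = False" by presburger+
  then show ?thesis by (simp only: 1 commutator_word_nth letter_sign.simps assms if_False)
next
  case (2 k)
  then have "(i = 4 * m + 1) = (k = m)" "(i = 4 * m + 3) = False" by presburger+
  then show ?thesis by (simp only: 2 commutator_word_nth letter_sign.simps assms if_False)
next
  case (3 k)
  then have "(i = 4 * m + 1) = False" "(i = 4 * m + 3) = False" by presburger+
  then show ?thesis by (simp only: 3 commutator_word_nth letter_sign.simps assms if_False)
next
  case (4 k)
  then have "(i = 4 * m + 1) = False" "(i = 4 * m + 3) = (k = m)" by presburger+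
  then show ?thesis by (simp only: 4 commutator_word_nth letter_sign.simps assms if_False)
qed

text \<open>Let \<open>u\<close>, \<open>v\<close> be the generators measured by \<open>\<alpha>\<close>, \<open>\<beta>\<close>. If they belong to the same commutator
  \<open>u\<^sup>-\<^sup>1v\<^sup>-\<^sup>1uv\<close>, the point \<open>(x, y)\<close> runs from \<open>(0,0)\<close> through \<open>(-1,0)\<close>, \<open>(-1,-1)\<close> and
  \<open>(0,-1)\<close> back to \<open>(0,0)\<close>, counterclockwise around a cell of area \<open>1\<close>. If they belong to different
  commutators, then \<open>x\<close> and \<open>y\<close> are never nonzero at the same time.\<close>

lemma simplex_area_commutator_word:
  assumes ab: "ordered_intervals a b" and f: "traverses \<rho> x0 (commutator_word c) a b f"
    and x0: "\<alpha> x0 = 1" "\<beta> x0 = 1"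
    and \<alpha>: "\<And>g s. s \<in> {0..1} \<Longrightarrow> \<alpha> (\<rho> g s) = (if g = fst (c m) then cis (2 * pi * s) else 1)"
    and \<beta>: "\<And>g s. s \<in> {0..1} \<Longrightarrow> \<beta> (\<rho> g s) = (if g = snd (c n) then cis (2 * pi * s) else 1)"
    and fst: "\<And>k. fst (c k) = fst (c m) \<longleftrightarrow> k = m" "\<And>k. snd (c k) \<noteq> fst (c m)"
    and snd: "\<And>k. snd (c k) = snd (c n) \<longleftrightarrow> k = n" "\<And>k. fst (c k) \<noteq> snd (c n)"
  shows "simplex_area \<alpha> \<beta> (loop_simplex f) = (if m = n then 1 else 0)"
proof -
  define P where "P = progress a b"
  define x where "x t = P (4 * m + 2) t - P (4 * m) t" for t
  define y where "y t = P (4 * n + 3) t - P (4 * n + 1) t" for t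
  \<comment> \<open>While \<open>x \<noteq> 0\<close>, the coordinate \<open>y\<close> moves only if \<open>m = n\<close>, from \<open>0\<close> to \<open>-1\<close> during the second letter
      of the commutator, where \<open>x = -1\<close>; so the integral grows from \<open>0\<close> to \<open>1\<close> there.\<close>
  define F where "F t = (if m = n then P (4 * m + 1) t else 0)" for t
  have cont: "continuous_on {0..1} x" "continuous_on {0..1} y" "continuous_on {0..1} F"
    unfolding x_def y_def F_def P_def
    by (cases "m = n"; auto intro!: continuous_intros continuous_on_progress)+
  have x: "\<alpha> (f t) = cis (2 * pi * x t)" if "t \<in> {0..1}" for t
  proof -
    have "\<alpha> (f t) = cis (2 * pi * (\<Sum>i\<in>{4 * m, 4 * m + 2}.
        letter_sign (fst (c m)) (commutator_word c i) * progress a b i t))"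
      by (rule angle_along_word[OF ab f _ _ x0(1) \<alpha> that])
        (auto simp: letter_sign_commutator_word_fst[OF fst])
    also have "(\<Sum>i\<in>{4 * m, 4 * m + 2}.
        letter_sign (fst (c m)) (commutator_word c i) * progress a b i t) = x t"
      by (simp add: letter_sign_commutator_word_fst[OF fst] x_def P_def)
    finally show ?thesis .
  qed
  have y: "\<beta> (f t) = cis (2 * pi * y t)" if "t \<in> {0..1}" for t
  proof -
    have "\<beta> (f t) = cis (2 * pi * (\<Sum>i\<in>{4 * n + 1, 4 * n + 3}.
        letter_sign (snd (c n)) (commutator_word c i) * progress a b i t))"
      by (rule angle_along_word[OF ab f _ _ x0(2) \<beta> that])
        (auto simp: letter_sign_commutator_word_snd[OF snd])
    also have "(\<Sum>i\<in>{4 * n + 1, 4 * n + 3}.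
        letter_sign (snd (c n)) (commutator_word c i) * progress a b i t) = y t"
      by (simp add: letter_sign_commutator_word_snd[OF snd] y_def P_def)
    finally show ?thesis .
  qed
  have PP: "P j t = 0 \<or> P i t = 1" if "i < j" for i j t
    using progress_consecutive[OF ab that] unfolding P_def by blast
  have xyF: "(x t \<in> \<int> \<or> y t \<in> \<int>) \<and> (x t \<in> \<int> \<longrightarrow> F t - x t * y t \<in> \<int>) \<and> (y t \<in> \<int> \<longrightarrow> F t \<in> \<int>)" for t
  proof (cases "m = n")
    case True
    consider "P (4 * m + 1) t = 0" "P (4 * m + 2) t = 0" "P (4 * m + 3) t = 0"
      | "P (4 * m) t = 1" "P (4 * m + 2) t = 0" "P (4 * m + 3) t = 0"
      | "P (4 * m) t = 1" "P (4 * m + 1) t = 1" "P (4 * m + 3) t = 0"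
      | "P (4 * m) t = 1" "P (4 * m + 1) t = 1" "P (4 * m + 2) t = 1"
      using PP[of "4 * m" "4 * m + 1" t] PP[of "4 * m" "4 * m + 2" t] PP[of "4 * m" "4 * m + 3" t]
        PP[of "4 * m + 1" "4 * m + 2" t] PP[of "4 * m + 1" "4 * m + 3" t] PP[of "4 * m + 2" "4 * m + 3" t]
      by force
    then show ?thesis
    proof cases
      case 3
      then have "F t - x t * y t = x t + 1" "y t = -1" "F t = 1" by (simp_all add: x_def y_def F_def True)
      then show ?thesis by simp
    qed (simp_all add: x_def y_def F_def True)
  next
    case False
    have "x t = 0 \<or> y t = 0"
    proof (cases "m < n")
      case True
      then show ?thesis
        using PP[of "4 * m" "4 * n + 1" t] PP[of "4 * m + 2" "4 * n + 1" t] PP[of "4 * n + 1" "4 * n + 3" t]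
        by (auto simp: x_def y_def)
    next
      case False
      then have "n < m" using \<open>m \<noteq> n\<close> by simp
      then show ?thesis
        using PP[of "4 * n + 1" "4 * m" t] PP[of "4 * n + 3" "4 * m" t] PP[of "4 * m" "4 * m + 2" t]
        by (auto simp: x_def y_def)
    qed
    then show ?thesis using False by (auto simp: F_def)
  qed
  have "area_lift {0..1} (\<lambda>t. \<alpha> (loop_simplex f (edge_point t))) (\<lambda>t. \<beta> (loop_simplex f (edge_point t))) x y F"
    unfolding area_lift_def
    using cont x y xyF by (auto simp only: loop_simplex_edge_point)
  then have "simplex_area \<alpha> \<beta> (loop_simplex f) = area_increment x y F 0 1"
    unfolding simplex_area_def by (rule path_area_eq)
  moreover have "P i 0 = 0" "P i 1 = 1" for i
    using progress_eq_0[OF ab, of 0 i] progress_eq_1[OF ab, of i 1] ab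
    unfolding P_def ordered_intervals_def by auto
  ultimately show ?thesis by (simp add: area_increment_def x_def y_def F_def)
qed

text \<open>If one coordinate is constant, no area is swept out.\<close>

lemma simplex_area_trivial:
  assumes \<sigma>: "singular_simplex 1 X \<sigma>" and W: "wedge_family X \<alpha> \<beta>"
    and triv: "(\<forall>z\<in>standard_simplex 1. \<alpha> m (\<sigma> z) = 1) \<or> (\<forall>z\<in>standard_simplex 1. \<beta> n (\<sigma> z) = 1)"
  shows "simplex_area (\<alpha> m) (\<beta> n) \<sigma> = 0"
proof -
  have lift: "\<exists>x. continuous_on {0..1} x \<and> (\<forall>t\<in>{0..1}. \<gamma> (\<sigma> (edge_point t)) = cis (2 * pi * x t)) \<and>
      ((\<forall>z\<in>standard_simplex 1. \<gamma> (\<sigma> z) = 1) \<longrightarrow> x = (\<lambda>_. 0))"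
    if \<gamma>: "continuous_map X (top_of_set (sphere 0 1)) \<gamma>" for \<gamma>
  proof (cases "\<forall>z\<in>standard_simplex 1. \<gamma> (\<sigma> z) = 1")
    case True
    then show ?thesis using edge_point_in by (intro exI[of _ "\<lambda>_. 0"]) simp
  next
    case False
    have "continuous_on {0..1} (\<lambda>t. \<gamma> (\<sigma> (edge_point t)))"
    proof (rule continuous_map_simplex_point[OF \<sigma>])
      show "continuous_map X euclidean \<gamma>" using \<gamma> by (simp add: continuous_map_in_subtopology)
      show "continuous_on {0..1} (\<lambda>t. edge_point t i)" for i
        unfolding edge_point_def by (cases "i = 0"; cases "i = 1") (auto intro!: continuous_intros)
    qed (rule edge_point_in)
    moreover have "norm (\<gamma> (\<sigma> (edge_point t))) = 1" if "t \<in> {0..1}" for t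
      using singular_simplex_in_topspace[OF \<sigma> edge_point_in[OF that]] \<gamma>
      by (auto simp: continuous_map_in_subtopology)
    ultimately obtain x where "continuous_on {0..1} x"
      "\<And>t. t \<in> {0..1} \<Longrightarrow> \<gamma> (\<sigma> (edge_point t)) = cis (2 * pi * x t)"
      using circle_valued_lift[of "{0..1}" "\<lambda>t. \<gamma> (\<sigma> (edge_point t))"] by auto
    then show ?thesis using False by auto
  qed
  have "continuous_map X (top_of_set (sphere 0 1)) (\<alpha> m)" using W unfolding wedge_family_def by blast
  from lift[OF this]
  obtain x where x: "continuous_on {0..1} x" "\<forall>t\<in>{0..1}. \<alpha> m (\<sigma> (edge_point t)) = cis (2 * pi * x t)"
      "(\<forall>z\<in>standard_simplex 1. \<alpha> m (\<sigma> z) = 1) \<longrightarrow> x = (\<lambda>_. 0)"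
    by (elim exE conjE)
  have "continuous_map X (top_of_set (sphere 0 1)) (\<beta> n)" using W unfolding wedge_family_def by blast
  from lift[OF this]
  obtain y where y: "continuous_on {0..1} y" "\<forall>t\<in>{0..1}. \<beta> n (\<sigma> (edge_point t)) = cis (2 * pi * y t)"
      "(\<forall>z\<in>standard_simplex 1. \<beta> n (\<sigma> z) = 1) \<longrightarrow> y = (\<lambda>_. 0)"
    by (elim exE conjE)
  have xy: "x = (\<lambda>_. 0) \<or> y = (\<lambda>_. 0)" using triv x(3) y(3) by blast
  then have "area_lift {0..1} (\<lambda>t. \<alpha> m (\<sigma> (edge_point t))) (\<lambda>t. \<beta> n (\<sigma> (edge_point t))) x y (\<lambda>_. 0)"
    unfolding area_lift_def using x(1,2) y(1,2) by auto
  then have "simplex_area (\<alpha> m) (\<beta> n) \<sigma> = area_increment x y (\<lambda>_. 0) 0 1"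
    unfolding simplex_area_def by (rule path_area_eq)
  then show ?thesis using xy by (auto simp: area_increment_def)
qed

section \<open>The class of a word does not depend on the intervals\<close>

lemma loop_class_cong:
  assumes "\<And>t. t \<in> {0..1} \<Longrightarrow> f t = g t"
  shows "loop_class X f = loop_class X g"
proof -
  have "loop_simplex f = loop_simplex g"
    using assms by (intro restrict_ext) (auto simp: standard_simplex_def)
  then show ?thesis by (simp only: loop_class_def)
qed

lemma loop_class_eq_iff:
  "loop_class X f = loop_class X g \<longleftrightarrow>
     homologous_rel 1 X {} (frag_of (loop_simplex f)) (frag_of (loop_simplex g))"
  unfolding loop_class_def by (rule homologous_rel_set_eq)

lemma singular_simplex_loop_simplex:
  assumes "pathin X f"
  shows "singular_simplex 1 X (loop_simplex f)"
proof -
  have "continuous_map (subtopology (powertop_real UNIV) (standard_simplex 1)) (top_of_set {0..1}) (\<lambda>x. x 1)"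
    unfolding continuous_map_in_subtopology
    by (auto simp: standard_simplex_def intro!: continuous_map_from_subtopology continuous_map_product_projection)
  then have "continuous_map (subtopology (powertop_real UNIV) (standard_simplex 1)) X (f \<circ> (\<lambda>x. x 1))"
    using assms continuous_map_compose unfolding pathin_def by blast
  then have "continuous_map (subtopology (powertop_real UNIV) (standard_simplex 1)) X (loop_simplex f)"
    by (rule continuous_map_eq) auto
  then show ?thesis by (simp add: singular_simplex_def)
qed

lemma singular_relcycle_loop_simplex:
  assumes "pathin X f" "f 0 = f 1"
  shows "singular_relcycle 1 X {} (frag_of (loop_simplex f))"
proof -
  have "loop_class X f \<in> carrier (homology_group 1 X)"
    by (rule loop_class_in_homology_group[OF assms])
  then obtain c where c: "singular_relcycle 1 X {} c" "loop_class X f = homologous_rel_set 1 X {} c"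
    using carrier_relative_homology_group[of 1 X "{}"] by auto
  then have "homologous_rel 1 X {} c (frag_of (loop_simplex f))"
    by (metis homologous_rel_set_eq loop_class_def)
  then show ?thesis using c(1) homologous_rel_singular_relcycle_1 by metis
qed

lemma chain_boundary_loop_simplex:
  "chain_boundary 1 (frag_of (loop_simplex f)) =
     frag_of (restrict (\<lambda>_. f 1) (standard_simplex 0)) - frag_of (restrict (\<lambda>_. f 0) (standard_simplex 0))"
proof -
  have face: "singular_face 1 k (loop_simplex f) = restrict (\<lambda>_. f (if k = 0 then 1 else 0)) (standard_simplex 0)"
    if "k \<le> 1" for k
  proof
    fix x
    show "singular_face 1 k (loop_simplex f) x = restrict (\<lambda>_. f (if k = 0 then 1 else 0)) (standard_simplex 0) x"
    proof (cases "x \<in> standard_simplex 0")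
      case True
      then have "simplical_face k x \<in> standard_simplex 1"
        using that by (intro simplical_face_in_standard_simplex) simp_all
      moreover have "simplical_face k x 1 = (if k = 0 then 1 else 0)"
        using True that by (auto simp: simplical_face_def standard_simplex_def le_Suc_eq)
      ultimately show ?thesis using True
        by (simp add: singular_face_def flip: One_nat_def)
    qed (simp add: singular_face_def)
  qed
  have "chain_boundary 1 (frag_of (loop_simplex f)) =
      frag_of (singular_face 1 0 (loop_simplex f)) - frag_of (singular_face 1 1 (loop_simplex f))"
    by (simp add: chain_boundary_of)
  then show ?thesis by (simp only: face[of 0] face[of 1] if_True if_False simp_thms one_neq_zero le_refl zero_le_one)
qed

text \<open>The path \<open>\<phi>\<close> and the identity path form a cycle in the contractible space \<open>[0,1]\<close>, hence a
  boundary, and \<open>f\<close> maps it to the difference of the two loops.\<close>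

lemma loop_class_reparametrize:
  assumes f: "pathin X f"
    and \<phi>: "continuous_on {0..1} \<phi>" "\<phi> ` {0..1} \<subseteq> {0..1}" "\<phi> 0 = 0" "\<phi> 1 = (1::real)"
  shows "loop_class X (f \<circ> \<phi>) = loop_class X f"
proof -
  let ?I = "top_of_set {0..1::real}"
  let ?c = "frag_of (loop_simplex \<phi>) - frag_of (loop_simplex (\<lambda>t. t))"
  have paths: "pathin ?I \<phi>" "pathin ?I (\<lambda>t. t)" using \<phi>(1,2) by (auto simp: pathin_def)
  have "singular_chain 1 ?I ?c" 
    using singular_simplex_loop_simplex[OF paths(1)] singular_simplex_loop_simplex[OF paths(2)]
    by (intro singular_chain_diff) (simp_all only: singular_chain_of)
  moreover have "chain_boundary 1 ?c = 0"
    using chain_boundary_loop_simplex[of "\<lambda>t. t"]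
    by (simp only: chain_boundary_diff chain_boundary_loop_simplex \<phi>(3,4) diff_self)
  ultimately have cyc: "singular_relcycle 1 ?I {} ?c" by (simp only: singular_cycle)
  have "contractible_space ?I"
    by (simp add: convex_imp_contractible)
  then have "trivial_group (reduced_homology_group 1 ?I)"
    by (rule trivial_reduced_homology_group_contractible_space)
  then have "trivial_group (homology_group 1 ?I)" by (simp add: un_reduced_homology_group)
  moreover have "homologous_rel_set 1 ?I {} ?c \<in> carrier (homology_group 1 ?I)"
    "homologous_rel_set 1 ?I {} 0 \<in> carrier (homology_group 1 ?I)"
    using cyc carrier_relative_homology_group[of 1 ?I "{}"] by auto
  ultimately have "homologous_rel_set 1 ?I {} ?c = homologous_rel_set 1 ?I {} 0"
    unfolding trivial_group_def by auto
  then have "singular_relboundary 1 ?I {} ?c"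
    by (simp only: homologous_rel_set_eq) (simp only: homologous_rel_def diff_zero)
  then have "singular_relboundary 1 X {} (chain_map 1 f ?c)"
    using f unfolding pathin_def by (rule singular_relboundary_chain_map) simp
  moreover have sm: "simplex_map 1 f (loop_simplex \<psi>) = loop_simplex (f \<circ> \<psi>)" for \<psi> :: "real \<Rightarrow> real"
    unfolding simplex_map_def by (rule restrict_ext) simp
  ultimately show ?thesis
    unfolding loop_class_eq_iff homologous_rel_def
    using sm[of "\<lambda>t. t"] by (simp add: chain_map_diff comp_def)
qed

text \<open>A monotone map of \<open>[0,1]\<close> to itself that sends the \<open>i\<close>-th interval affinely to the \<open>i\<close>-th dyadic
  interval \<open>[1 - 1/2^i, 1 - 1/2^(i+1)]\<close> and is constant on the gaps.\<close>

definition schedule :: "(nat \<Rightarrow> real) \<Rightarrow> (nat \<Rightarrow> real) \<Rightarrow> real \<Rightarrow> real" where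
  "schedule a b t = suminf (\<lambda>i. progress a b i t * (1 / 2) ^ Suc i)"

lemma half_powers_sum: "(\<Sum>j<i. (1 / 2) ^ Suc j) = 1 - (1 / 2 :: real) ^ i"
  by (induction i) (auto simp: field_simps)

lemma continuous_on_schedule: "continuous_on {0..1} (schedule a b)"
proof -
  have "uniform_limit {0..1} (\<lambda>n t. \<Sum>i<n. progress a b i t * (1 / 2) ^ Suc i) (schedule a b) sequentially"
    unfolding schedule_def[abs_def]
  proof (rule Weierstrass_m_test)
    show "summable (\<lambda>i. (1 / 2 :: real) ^ Suc i)" using power_half_series sums_summable by blast
    show "norm (progress a b i t * (1 / 2) ^ Suc i) \<le> (1 / 2) ^ Suc i" for i t
      using progress_bounds[of a b i t] by (simp add: mult_le_cancel_right1)
  qed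
  then show ?thesis
    by (rule uniform_limit_theorem[rotated])
      (auto intro!: always_eventually continuous_intros continuous_on_progress)
qed

lemma schedule_prefix:
  assumes "\<And>j. j < i \<Longrightarrow> progress a b j t = 1" "\<And>j. i < j \<Longrightarrow> progress a b j t = 0"
  shows "schedule a b t = 1 - (1 / 2) ^ i + progress a b i t * (1 / 2) ^ Suc i"
proof -
  have "schedule a b t = (\<Sum>j<Suc i. progress a b j t * (1 / 2) ^ Suc j)"
    unfolding schedule_def using assms(2) by (intro suminf_finite) auto
  also have "\<dots> = (\<Sum>j<i. (1 / 2) ^ Suc j) + progress a b i t * (1 / 2) ^ Suc i"
    using assms(1) by simp
  finally show ?thesis by (simp only: half_powers_sum)
qed

abbreviation dyadic_start :: "nat \<Rightarrow> real" where "dyadic_start i \<equiv> 1 - (1 / 2) ^ i"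
abbreviation dyadic_end :: "nat \<Rightarrow> real" where "dyadic_end i \<equiv> 1 - (1 / 2) ^ Suc i"

lemma ordered_intervals_dyadic: "ordered_intervals dyadic_start dyadic_end"
  by (auto simp: ordered_intervals_def power_le_one)

text \<open>Outside the intervals, the letters that have been completed form an initial segment of the word.\<close>

lemma schedule_outside:
  assumes ab: "ordered_intervals a b" and t: "\<And>i. t \<notin> {a i<..<b i}"
  shows "schedule a b t = 1 \<or> (\<exists>j. schedule a b t = dyadic_start j)"
proof (cases "\<exists>i. progress a b i t = 0")
  case True
  define j where "j = (LEAST i. progress a b i t = 0)"
  have j: "progress a b j t = 0" unfolding j_def using LeastI_ex[OF True] .
  have "progress a b i t = 1" if "i < j" for i
    using not_less_Least[OF that[unfolded j_def]] progress_outside[OF ab t[of i]] by auto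
  moreover have "progress a b i t = 0" if "j < i" for i
    using progress_consecutive[OF ab that, of t] j by auto
  ultimately have "schedule a b t = dyadic_start j" using schedule_prefix[of j a b t] j by simp
  then show ?thesis by blast
next
  case False
  then have "progress a b i t = 1" for i using progress_outside[OF ab t[of i]] by blast
  then have "schedule a b t = 1" using power_half_series by (simp add: schedule_def sums_unique[symmetric])
  then show ?thesis by blast
qed

lemma schedule_bounds:
  assumes "ordered_intervals a b"
  shows "schedule a b t \<in> {0..1}"
proof (cases "\<exists>i. t \<in> {a i<..<b i}")
  case True
  then obtain i where i: "t \<in> {a i<..<b i}" by blast
  have "schedule a b t = 1 - (1 / 2) ^ i + progress a b i t * (1 / 2) ^ Suc i"
    by (rule schedule_prefix) (use progress_other[OF assms i] in auto)
  moreover have "0 \<le> progress a b i t * (1 / 2) ^ Suc i" "progress a b i t * (1 / 2) ^ Suc i \<le> 1 * (1 / 2) ^ Suc i"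
    using progress_bounds by (auto intro!: mult_right_mono)
  moreover have "(1 / 2 :: real) ^ i \<le> 1" "0 \<le> (1 / 2 :: real) ^ i" by (auto simp: power_le_one)
  ultimately show ?thesis by simp
next
  case False
  then show ?thesis using schedule_outside[OF assms, of t] by (auto simp: power_le_one)
qed

lemma traverses_schedule:
  assumes ab: "ordered_intervals a b" and f: "traverses \<rho> x0 w a b f"
    and f0: "traverses \<rho> x0 w dyadic_start dyadic_end f0" and t: "t \<in> {0..1}"
  shows "f t = f0 (schedule a b t)"
proof (cases "\<exists>i. t \<in> {a i<..<b i}")
  case True
  then obtain i where i: "t \<in> {a i<..<b i}" by blast
  let ?s = "progress a b i t"
  have sch: "schedule a b t = dyadic_start i + ?s * (1 / 2) ^ Suc i"
    by (rule schedule_prefix) (use progress_other[OF ab i] in auto)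
  have len: "dyadic_end i - dyadic_start i = (1 / 2) ^ Suc i" by simp
  have "?s * (1 / 2) ^ Suc i < 1 * (1 / 2) ^ Suc i" "0 < ?s * (1 / 2) ^ Suc i"
    using progress_inside[OF ab i] by (intro mult_strict_right_mono mult_pos_pos; simp)+
  then have "schedule a b t \<in> {dyadic_start i<..<dyadic_end i}"
    using len unfolding sch greaterThanLessThan_iff mult_1 by linarith
  then have "f0 (schedule a b t) =
      letter_loop \<rho> (w i) ((schedule a b t - dyadic_start i) / (dyadic_end i - dyadic_start i))"
    using f0 unfolding traverses_def by blast
  also have "(schedule a b t - dyadic_start i) / (dyadic_end i - dyadic_start i) = ?s"
    unfolding len sch by simp
  also have "letter_loop \<rho> (w i) ?s = f t"
    using f i unfolding traverses_def by (simp add: progress_inside(1)[OF ab i])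
  finally show ?thesis by simp
next
  case False
  have "schedule a b t \<notin> {dyadic_start i<..<dyadic_end i}" for i
  proof -
    consider "schedule a b t = 1" | j where "schedule a b t = dyadic_start j"
      using schedule_outside[OF ab, of t] False by blast
    then show ?thesis
    proof cases
      case (2 j)
      have "dyadic_end i \<le> dyadic_start j" if "i < j"
        by (rule ordered_intervals_le[OF ordered_intervals_dyadic that])
      moreover have "dyadic_start j \<le> dyadic_start i" if "j \<le> i"
        using that by (simp add: power_decreasing)
      ultimately show ?thesis unfolding 2 by (cases "i < j") force+
    qed simp
  qed
  then have "f0 (schedule a b t) = x0"
    using f0 schedule_bounds[OF ab, of t] unfolding traverses_def by blast
  moreover have "f t = x0" using f t False unfolding traverses_def by blast
  ultimately show ?thesis by simp
qed

text \<open>At an accumulation point of the intervals continuity is not local: it holds because the loops of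
  the letters shrink to the base point. The loop is the uniform limit of the loops that traverse only
  the first \<open>n\<close> letters, and these are finite sums of continuous functions, as at any time at most one
  summand differs from the base point \<open>0\<close>.\<close>

lemma traverses_continuous:
  fixes \<rho> :: "'g \<Rightarrow> real \<Rightarrow> 'a::real_normed_vector"
  assumes ab: "ordered_intervals a b" and f: "traverses \<rho> 0 w a b f"
    and L: "\<And>i. continuous_on {0..1} (letter_loop \<rho> (w i))"
      "\<And>i. letter_loop \<rho> (w i) 0 = 0" "\<And>i. letter_loop \<rho> (w i) 1 = 0"
    and small: "\<And>e. 0 < e \<Longrightarrow> \<exists>N. \<forall>i\<ge>N. \<forall>s\<in>{0..1}. norm (letter_loop \<rho> (w i) s) < e"
  shows "continuous_on {0..1} f"
proof -
  define h where "h i t = letter_loop \<rho> (w i) (progress a b i t)" for i t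
  have h_cont: "continuous_on {0..1} (h i)" for i
    unfolding h_def[abs_def]
    by (rule continuous_on_compose2[OF L(1) continuous_on_progress]) (auto simp: progress_bounds)
  have h_0: "h j t = 0" if "t \<notin> {a j<..<b j}" for j t
    using progress_outside[OF ab that] L(2,3) by (auto simp: h_def)
  have h_other: "h j t = 0" if "t \<in> {a i<..<b i}" "j \<noteq> i" for i j t
    using progress_other[OF ab that(1), of j] that(2) L(2,3) by (cases "j < i") (auto simp: h_def)
  have f_inside: "f t = h i t" if "t \<in> {a i<..<b i}" for i t
    using f that unfolding traverses_def h_def by (simp add: progress_inside(1)[OF ab that])
  have "uniform_limit {0..1} (\<lambda>n t. \<Sum>i<n. h i t) f sequentially"
  proof (rule uniform_limitI)
    fix e :: real assume e: "0 < e"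
    obtain N where N: "\<And>i s. N \<le> i \<Longrightarrow> s \<in> {0..1} \<Longrightarrow> norm (letter_loop \<rho> (w i) s) < e"
      using small[OF e] by blast
    have "dist (\<Sum>i<n. h i t) (f t) < e" if n: "N \<le> n" and t: "t \<in> {0..1}" for n t
    proof (cases "\<exists>i. t \<in> {a i<..<b i}")
      case True
      then obtain i where i: "t \<in> {a i<..<b i}" by blast
      have "(\<Sum>j<n. h j t) = (if i < n then h i t else 0)"
      proof (cases "i < n")
        case True
        have "(\<Sum>j<n. h j t) = (\<Sum>j\<in>{i}. h j t)"
          using True h_other[OF i] by (intro sum.mono_neutral_right) auto
        then show ?thesis using True by simp
      next
        case False
        then show ?thesis using h_other[OF i] by (auto intro!: sum.neutral)
      qed
      moreover have "norm (h i t) < e" if "\<not> i < n"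
        using N[of i "progress a b i t"] n that progress_bounds[of a b i t] by (simp add: h_def)
      ultimately show ?thesis using f_inside[OF i] e by (simp add: dist_norm)
    next
      case False
      then have "f t = 0" using f t unfolding traverses_def by blast
      moreover have "(\<Sum>j<n. h j t) = 0" using False h_0 by (intro sum.neutral) blast
      ultimately show ?thesis using e by simp
    qed
    then show "\<forall>\<^sub>F n in sequentially. \<forall>t\<in>{0..1}. dist (\<Sum>i<n. h i t) (f t) < e"
      using eventually_sequentially by blast
  qed
  then show ?thesis
    by (rule uniform_limit_theorem[rotated])
      (auto intro!: always_eventually continuous_intros h_cont)
qed

lemma word_defines_element:
  fixes \<rho> :: "'g \<Rightarrow> real \<Rightarrow> 'a::real_normed_vector"
  assumes fin: "\<And>l. finite {i. w i = l}" and S: "0 \<in> S"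
    and L: "\<And>i. continuous_on {0..1} (letter_loop \<rho> (w i))"
      "\<And>i. letter_loop \<rho> (w i) 0 = 0" "\<And>i. letter_loop \<rho> (w i) 1 = 0"
      "\<And>i s. s \<in> {0..1} \<Longrightarrow> letter_loop \<rho> (w i) s \<in> S"
    and small: "\<And>e. 0 < e \<Longrightarrow> \<exists>N. \<forall>i\<ge>N. \<forall>s\<in>{0..1}. norm (letter_loop \<rho> (w i) s) < e"
  shows "defines_element (top_of_set S) \<rho> 0 w"
    "\<exists>a b f. ordered_intervals a b \<and> traverses \<rho> 0 w a b f \<and> pathin (top_of_set S) f \<and> f 0 = 0 \<and> f 1 = 0 \<and>
       f ` {0..1} \<subseteq> insert 0 (\<Union>i. letter_loop \<rho> (w i) ` {0..1}) \<and>
       word_class (top_of_set S) \<rho> 0 w = loop_class (top_of_set S) f"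
proof -
  let ?X = "top_of_set S"
  have path: "pathin ?X f" "f 0 = 0" "f 1 = 0" "f ` {0..1} \<subseteq> insert 0 (\<Union>i. letter_loop \<rho> (w i) ` {0..1})"
    if ab: "ordered_intervals a b" and f: "traverses \<rho> 0 w a b f" for a b f
  proof -
    have vals: "f t = 0 \<or> (\<exists>i. \<exists>s\<in>{0..1}. f t = letter_loop \<rho> (w i) s)" if t: "t \<in> {0..1}" for t
    proof (cases "\<exists>i. t \<in> {a i<..<b i}")
      case True
      then obtain i where i: "t \<in> {a i<..<b i}" by blast
      have "f t = letter_loop \<rho> (w i) (progress a b i t)"
        using f i unfolding traverses_def by (simp add: progress_inside(1)[OF ab i])
      moreover have "progress a b i t \<in> {0..1}" using progress_bounds[of a b i t] by simp
      ultimately show ?thesis by blast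
    qed (use f t in \<open>auto simp: traverses_def\<close>)
    then show "f ` {0..1} \<subseteq> insert 0 (\<Union>i. letter_loop \<rho> (w i) ` {0..1})" by blast
    have "f t \<in> S" if "t \<in> {0..1}" for t using vals[OF that] S L(4) by auto
    then show "pathin ?X f"
      using traverses_continuous[OF ab f L(1-3) small] by (auto simp: pathin_def)
    have "0 \<notin> {a i<..<b i}" "1 \<notin> {a i<..<b i}" for i
      using ab unfolding ordered_intervals_def by (auto simp: not_less)
    then show "f 0 = 0" "f 1 = 0" using f unfolding traverses_def by auto
  qed
  define f0 where "f0 t = (if \<exists>i. t \<in> {dyadic_start i<..<dyadic_end i}
      then let i = (SOME i. t \<in> {dyadic_start i<..<dyadic_end i}) in
        letter_loop \<rho> (w i) ((t - dyadic_start i) / (dyadic_end i - dyadic_start i)) else 0)" for t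
  have f0: "traverses \<rho> 0 w dyadic_start dyadic_end f0"
    unfolding traverses_def
  proof (intro conjI allI ballI)
    fix i t assume t: "t \<in> {dyadic_start i<..<dyadic_end i}"
    have "j = i" if "t \<in> {dyadic_start j<..<dyadic_end j}" for j
      using that t ordered_intervals_le[OF ordered_intervals_dyadic, of i j]
        ordered_intervals_le[OF ordered_intervals_dyadic, of j i]
      by (meson greaterThanLessThan_iff less_trans linorder_neqE_nat not_le order_trans)
    then have some: "(SOME i. t \<in> {dyadic_start i<..<dyadic_end i}) = i" using t by (intro some_equality)
    have ex: "\<exists>i. t \<in> {dyadic_start i<..<dyadic_end i}" using t by blast
    show "f0 t = letter_loop \<rho> (w i) ((t - dyadic_start i) / (dyadic_end i - dyadic_start i))"
      unfolding f0_def Let_def some if_P[OF ex] ..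
  next
    fix t assume "t \<in> {0..1} - (\<Union>i. {dyadic_start i<..<dyadic_end i})"
    then have "\<not> (\<exists>i. t \<in> {dyadic_start i<..<dyadic_end i})" by blast
    then show "f0 t = 0" unfolding f0_def by (simp only: if_False)
  qed
  note p0 = path[OF ordered_intervals_dyadic f0]
  have rep: "represents_class ?X \<rho> 0 w c \<longleftrightarrow> c = loop_class ?X f0" for c
  proof
    assume "represents_class ?X \<rho> 0 w c"
    then obtain a b f where ab: "ordered_intervals a b" and f: "traverses \<rho> 0 w a b f" "c = loop_class ?X f"
      unfolding represents_class_def by blast
    have "schedule a b 0 = 0" "schedule a b 1 = 1"
    proof -
      have "progress a b i 0 = 0" "progress a b i 1 = 1" for i
        using progress_eq_0[OF ab, of 0 i] progress_eq_1[OF ab, of i 1] ab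
        unfolding ordered_intervals_def by auto
      then show "schedule a b 0 = 0" "schedule a b 1 = 1"
        using power_half_series by (simp_all add: schedule_def sums_unique[symmetric])
    qed
    then have "loop_class ?X (f0 \<circ> schedule a b) = loop_class ?X f0"
      using schedule_bounds[OF ab]
      by (intro loop_class_reparametrize p0(1) continuous_on_schedule) auto
    moreover have "loop_class ?X f = loop_class ?X (f0 \<circ> schedule a b)"
      using traverses_schedule[OF ab f(1) f0] by (intro loop_class_cong) simp
    ultimately show "c = loop_class ?X f0" using f(2) by simp
  next
    assume "c = loop_class ?X f0"
    then show "represents_class ?X \<rho> 0 w c"
      unfolding represents_class_def
      using loop_class_in_homology_group[OF p0(1)] p0 f0 ordered_intervals_dyadic by auto
  qed
  then show "defines_element ?X \<rho> 0 w" using fin by (simp add: defines_element_def)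
  have "word_class ?X \<rho> 0 w = loop_class ?X f0" unfolding word_class_def rep by simp
  then show "\<exists>a b f. ordered_intervals a b \<and> traverses \<rho> 0 w a b f \<and> pathin ?X f \<and> f 0 = 0 \<and> f 1 = 0 \<and>
       f ` {0..1} \<subseteq> insert 0 (\<Union>i. letter_loop \<rho> (w i) ` {0..1}) \<and>
       word_class ?X \<rho> 0 w = loop_class ?X f"
    using ordered_intervals_dyadic f0 p0 by blast
qed

section \<open>Angles on the Hawaiian Earring\<close>

text \<open>On the \<open>n\<close>-th circle the angle is \<open>1 - n z\<close>. The inversion \<open>z \<mapsto> 1/z\<close> sends the \<open>m\<close>-th circle to
  the line \<open>Re = m/2\<close>, so the last factor is \<open>1\<close> on the \<open>n\<close>-th circle and \<open>0\<close> on the others.\<close>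

definition angle :: "nat \<Rightarrow> complex \<Rightarrow> complex" where
  "angle n z = 1 - of_nat n * z * of_real (max 0 (1 - \<bar>2 * Re (1 / z) - real n\<bar>))"

lemma angle_0: "angle n 0 = 1"
  by (simp add: angle_def)

text \<open>The cut-off factor is discontinuous at \<open>0\<close>, but it is bounded and multiplied by \<open>z\<close>.\<close>

lemma continuous_on_angle: "continuous_on UNIV (angle n)"
proof -
  have "isCont (angle n) z" for z
  proof (cases "z = 0")
    case True
    have "((\<lambda>z. angle n z - 1) \<longlongrightarrow> 0) (at 0)"
    proof (rule Lim_null_comparison)
      have "norm (angle n z - 1) \<le> real n * norm z" for z
      proof -
        define h where "h = max 0 (1 - \<bar>2 * Re (1 / z) - real n\<bar>)"
        have "0 \<le> h" "h \<le> 1" by (auto simp: h_def)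
        have "norm (angle n z - 1) = (real n * norm z) * h"
          using \<open>0 \<le> h\<close> by (simp add: angle_def norm_mult flip: h_def)
        also have "\<dots> \<le> (real n * norm z) * 1" using \<open>h \<le> 1\<close> by (intro mult_left_mono) auto
        finally show ?thesis by simp
      qed
      then show "\<forall>\<^sub>F z in at 0. norm (angle n z - 1) \<le> real n * norm z" by simp
      show "((\<lambda>z::complex. real n * norm z) \<longlongrightarrow> 0) (at 0)" by (auto intro!: tendsto_eq_intros)
    qed
    then have "(angle n \<longlongrightarrow> 1) (at 0)" by (simp add: LIM_zero_iff)
    then show ?thesis by (simp add: True isCont_def angle_0)
  next
    case False
    have "continuous_on (- {0}) (angle n)"
      unfolding angle_def[abs_def] by (intro continuous_intros) auto
    moreover have "open (- {0 :: complex})" by auto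
    ultimately show ?thesis using False continuous_on_eq_continuous_at by blast
  qed
  then show ?thesis by (simp add: continuous_on_eq_continuous_at)
qed

lemma angle_left_half_plane: "n \<ge> 1 \<Longrightarrow> Re z \<le> 0 \<Longrightarrow> angle n z = 1"
proof -
  assume n: "n \<ge> 1" and z: "Re z \<le> 0"
  have "Re (1 / z) \<le> 0" using z by (simp add: Re_divide divide_nonpos_nonneg)
  then have "1 - \<bar>2 * Re (1 / z) - real n\<bar> \<le> 0" using n by simp
  then have "max 0 (1 - \<bar>2 * Re (1 / z) - real n\<bar>) = 0" by (rule max_absorb1)
  then show "angle n z = 1" by (simp only: angle_def) simp
qed

lemma Re_inverse_circle_loop:
  assumes "circle_loop m t \<noteq> 0"
  shows "2 * Re (1 / circle_loop m t) = real m"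
proof -
  define C where "C = cos (2 * pi * t)"
  define D where "D = sin (2 * pi * t)"
  have m: "m \<noteq> 0" using assms by (auto simp: circle_loop_def)
  have re: "Re (circle_loop m t) = (1 - C) / real m" "Im (circle_loop m t) = - D / real m"
    by (simp_all add: circle_loop_def C_def D_def)
  have CD: "C\<^sup>2 + D\<^sup>2 = 1" by (simp add: C_def D_def)
  have "C \<noteq> 1"
  proof
    assume "C = 1"
    then have "D = 0" using CD by simp
    then show False using assms re \<open>C = 1\<close> by (simp add: complex_eq_iff)
  qed
  have "((1 - C) / real m)\<^sup>2 + (- D / real m)\<^sup>2 = ((1 - 2 * C + (C\<^sup>2 + D\<^sup>2))) / (real m)\<^sup>2"
    by (simp add: power_divide power2_diff add_divide_distrib[symmetric])
  also have "\<dots> = 2 * (1 - C) / (real m)\<^sup>2" unfolding CD by simp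
  finally have "2 * Re (1 / circle_loop m t) = 2 * ((1 - C) / real m / (2 * (1 - C) / (real m)\<^sup>2))"
    by (simp only: Re_divide re) simp
  also have "\<dots> = real m" using m \<open>C \<noteq> 1\<close> by (simp add: field_simps power2_eq_square)
  finally show ?thesis .
qed

lemma angle_circle_loop:
  assumes n: "n \<ge> 1"
  shows "angle n (circle_loop m t) = (if m = n then cis (2 * pi * t) else 1)"
proof (cases "circle_loop m t = 0")
  case True
  then have "m = 0 \<or> cis (2 * pi * t) = 1" by (auto simp: circle_loop_def)
  then show ?thesis using True n by (auto simp: angle_0)
next
  case False
  note Re_inverse_circle_loop[OF False]
  then have "angle n (circle_loop m t) =
      1 - of_nat n * circle_loop m t * of_real (max 0 (1 - \<bar>real m - real n\<bar>))"
    by (simp only: angle_def)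
  moreover have "max 0 (1 - \<bar>real m - real n\<bar>) = (if m = n then 1 else 0)"
    by (auto simp: max_def)
  ultimately show ?thesis using n by (auto simp: circle_loop_def)
qed

lemma hawaiian_earring_cases:
  assumes "z \<in> hawaiian_earring"
  obtains m t where "m \<ge> 1" "t \<in> {0..1}" "z = circle_loop m t"
  using assms path_image_circle_loop unfolding hawaiian_earring_def path_image_def by blast

lemma circle_loop_in_hawaiian_earring: "m \<ge> 1 \<Longrightarrow> t \<in> {0..1} \<Longrightarrow> circle_loop m t \<in> hawaiian_earring"
  using path_image_circle_loop[of m] unfolding hawaiian_earring_def path_image_def by blast

lemma norm_angle_hawaiian_earring: "n \<ge> 1 \<Longrightarrow> z \<in> hawaiian_earring \<Longrightarrow> norm (angle n z) = 1"
  by (elim hawaiian_earring_cases) (simp add: angle_circle_loop)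

lemma angle_hawaiian_earring_wedge:
  "i \<ge> 1 \<Longrightarrow> j \<ge> 1 \<Longrightarrow> i \<noteq> j \<Longrightarrow> z \<in> hawaiian_earring \<Longrightarrow> angle i z = 1 \<or> angle j z = 1"
  by (elim hawaiian_earring_cases) (simp add: angle_circle_loop)

lemma Re_hawaiian_earring: "z \<in> hawaiian_earring \<Longrightarrow> 0 \<le> Re z"
  by (elim hawaiian_earring_cases) (simp add: circle_loop_def)

lemma wedge_family_hawaiian_earring:
  assumes "\<And>m. i m \<ge> 1" "\<And>n. j n \<ge> 1" "\<And>m n. i m \<noteq> j n"
  shows "wedge_family (top_of_set hawaiian_earring) (\<lambda>m. angle (i m)) (\<lambda>n. angle (j n))"
proof -
  have "continuous_on hawaiian_earring (angle n)" for n
    using continuous_on_angle continuous_on_subset by blast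
  then show ?thesis
    unfolding wedge_family_def
    using assms norm_angle_hawaiian_earring angle_hawaiian_earring_wedge by auto
qed

lemma circle_loop_properties:
  "continuous_on C (circle_loop m)" "circle_loop m 0 = 0" "circle_loop m 1 = 0"
  "norm (circle_loop m t) \<le> 2 / real m"
proof -
  show "continuous_on C (circle_loop m)"
    unfolding circle_loop_def[abs_def] by (intro continuous_intros)
  show "circle_loop m 0 = 0" "circle_loop m 1 = 0" by (simp_all add: circle_loop_def)
  have "norm (1 - cis (2 * pi * t)) \<le> 2" using norm_triangle_ineq4[of 1 "cis (2 * pi * t)"] by simp
  then have "1 / real m * norm (1 - cis (2 * pi * t)) \<le> 1 / real m * 2"
    by (intro mult_left_mono) auto
  then show "norm (circle_loop m t) \<le> 2 / real m"
    by (simp only: circle_loop_def norm_mult norm_of_real) simp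
qed

section \<open>Angles on Griffiths' space\<close>

text \<open>The angle of the circle \<open>p\<^sub>n\<close>, extended along the generating segments of the cone over \<open>H(P)\<close>.
  On the other cone the argument lies in the left half plane, so that the value is \<open>1\<close>. The angle of
  \<open>q\<^sub>n\<close> is \<open>cone_angle n (- x)\<close>, as the point reflection exchanges the two cones. At the apexes, where
  \<open>\<bar>snd x\<bar> = 1\<close>, it is discontinuous.\<close>

definition cone_angle :: "nat \<Rightarrow> complex \<times> real \<Rightarrow> complex" where
  "cone_angle n x = angle n (fst x /\<^sub>R (1 - \<bar>snd x\<bar>))"

lemma continuous_on_cone_angle: "continuous_on {x. \<bar>snd x\<bar> < 1} (cone_angle n)"
  unfolding cone_angle_def[abs_def]
  by (rule continuous_on_compose2[OF continuous_on_angle]) (auto intro!: continuous_intros)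

lemma cone_over_cases:
  assumes "x \<in> cone_over H"
  obtains z s where "z \<in> H" "0 \<le> s" "s \<le> 1" "x = ((1 - s) *\<^sub>R z, s)"
  using assms unfolding cone_over_def cone_map_def by auto

lemma cone_angle_cone_over:
  assumes "x \<in> cone_over hawaiian_earring" "\<bar>snd x\<bar> < 1" "n \<ge> 1"
  shows "norm (cone_angle n x) = 1" "cone_angle n (- x) = 1"
proof -
  obtain z s where x: "z \<in> hawaiian_earring" "0 \<le> s" "s \<le> 1" "x = ((1 - s) *\<^sub>R z, s)"
    using cone_over_cases[OF assms(1)] by metis
  have s: "s < 1" using assms(2) x by simp
  then have "cone_angle n x = angle n z" "cone_angle n (- x) = angle n (- z)"
    using x by (simp_all add: cone_angle_def)
  then show "norm (cone_angle n x) = 1" "cone_angle n (- x) = 1"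
    using x(1) assms(3) Re_hawaiian_earring[OF x(1)]
    by (simp_all add: norm_angle_hawaiian_earring angle_left_half_plane)
qed

lemma griffiths_space_cases:
  assumes "x \<in> griffiths_space"
  shows "x \<in> cone_over hawaiian_earring \<and> 0 \<le> snd x \<or> - x \<in> cone_over hawaiian_earring \<and> snd x \<le> 0"
proof -
  have "0 \<le> snd y" if "y \<in> cone_over hawaiian_earring" for y
    using that by (rule cone_over_cases) simp
  then show ?thesis using assms unfolding griffiths_space_def by fastforce
qed

lemma cone_angle_griffiths_space:
  assumes x: "x \<in> griffiths_space" "\<bar>snd x\<bar> < 1" and n: "n \<ge> 1"
  shows "norm (cone_angle n x) = 1" "norm (cone_angle n (- x)) = 1"
    "m \<ge> 1 \<Longrightarrow> cone_angle m x = 1 \<or> cone_angle n (- x) = 1"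
    "0 < snd x \<Longrightarrow> cone_angle n (- x) = 1" "snd x < 0 \<Longrightarrow> cone_angle n x = 1"
proof -
  have *: "cone_angle k x = 1" if "- x \<in> cone_over hawaiian_earring" "k \<ge> 1" for k
    using cone_angle_cone_over(2)[OF that(1) _ that(2)] x(2) by simp
  have **: "cone_angle k (- x) = 1" if "x \<in> cone_over hawaiian_earring" "k \<ge> 1" for k
    using cone_angle_cone_over(2)[OF that(1) x(2) that(2)] by simp
  note cases = griffiths_space_cases[OF x(1)]
  show "norm (cone_angle n x) = 1" "norm (cone_angle n (- x)) = 1"
    using cases * ** cone_angle_cone_over(1)[OF _ x(2) n]
      cone_angle_cone_over(1)[of "- x" n] x(2) n by auto
  show "cone_angle m x = 1 \<or> cone_angle n (- x) = 1" if "m \<ge> 1"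
    using cases * ** n that by blast
  show "cone_angle n (- x) = 1" if "0 < snd x" using cases ** n that by auto
  show "cone_angle n x = 1" if "snd x < 0" using cases * n that by auto
qed

lemma continuous_map_cone_angle:
  assumes "n \<ge> 1" "C \<subseteq> griffiths_space" "\<And>x. x \<in> C \<Longrightarrow> \<bar>snd x\<bar> < 1"
  shows "continuous_map (top_of_set C) (top_of_set (sphere 0 1)) (cone_angle n)"
    "continuous_map (top_of_set C) (top_of_set (sphere 0 1)) (\<lambda>x. cone_angle n (- x))"
proof -
  have "continuous_on C (cone_angle n)"
    using continuous_on_cone_angle by (rule continuous_on_subset) (use assms in auto)
  moreover have "continuous_on C (\<lambda>x. cone_angle n (- x))"
    by (rule continuous_on_compose2[OF continuous_on_cone_angle])
      (use assms in \<open>auto intro!: continuous_intros\<close>)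
  ultimately show "continuous_map (top_of_set C) (top_of_set (sphere 0 1)) (cone_angle n)"
    "continuous_map (top_of_set C) (top_of_set (sphere 0 1)) (\<lambda>x. cone_angle n (- x))"
    using assms cone_angle_griffiths_space(1,2)[OF _ _ assms(1)] by (auto simp: subset_eq)
qed

text \<open>Griffiths' space without closed neighbourhoods of the apexes; all angles are continuous here.\<close>

definition griffiths_waist :: "(complex \<times> real) set" where
  "griffiths_waist = {x \<in> griffiths_space. \<bar>snd x\<bar> < 3 / 4}"

definition griffiths_tips :: "(complex \<times> real) set" where
  "griffiths_tips = {x \<in> griffiths_waist. 1 / 2 < \<bar>snd x\<bar>}"

lemma wedge_family_griffiths:
  assumes "\<And>m. i m \<ge> 1" "\<And>n. j n \<ge> 1"
  shows "wedge_family (top_of_set griffiths_waist) (\<lambda>m. cone_angle (i m)) (\<lambda>n x. cone_angle (j n) (- x))"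
proof -
  have "continuous_map (top_of_set griffiths_waist) (top_of_set (sphere 0 1)) (cone_angle n)"
    "continuous_map (top_of_set griffiths_waist) (top_of_set (sphere 0 1)) (\<lambda>x. cone_angle n (- x))"
    if "n \<ge> 1" for n
    by (rule continuous_map_cone_angle[OF that]; force simp: griffiths_waist_def)+
  moreover have "cone_angle (i m) x = 1 \<or> cone_angle (j n) (- x) = 1" if "x \<in> griffiths_waist" for m n x
    using that assms by (intro cone_angle_griffiths_space(3)) (auto simp: griffiths_waist_def)
  ultimately show ?thesis unfolding wedge_family_def using assms by auto
qed

text \<open>A simplex in the tips is connected and therefore stays in one of the two cones, where the angles of
  the other Earring are \<open>1\<close>.\<close>

lemma simplex_area_griffiths_tips:
  fixes i j :: "nat \<Rightarrow> nat"
  assumes ij: "\<And>m. i m \<ge> 1" "\<And>n. j n \<ge> 1"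
    and \<sigma>: "singular_simplex 1 (subtopology (top_of_set griffiths_waist) griffiths_tips) \<sigma>"
  shows "simplex_area (cone_angle (i m)) (\<lambda>x. cone_angle (j n) (- x)) \<sigma> = 0"
proof -
  let ?D = "standard_simplex 1"
  have \<sigma>': "singular_simplex 1 (top_of_set griffiths_waist) \<sigma>" "\<sigma> ` ?D \<subseteq> griffiths_tips"
    using \<sigma> unfolding singular_simplex_subtopology by auto
  have "continuous_map (subtopology (powertop_real UNIV) ?D) euclideanreal (snd \<circ> \<sigma>)"
  proof (rule continuous_map_compose)
    show "continuous_map (subtopology (powertop_real UNIV) ?D) euclidean \<sigma>"
      using \<sigma>'(1) unfolding singular_simplex_def by (simp add: continuous_map_in_subtopology)
    show "continuous_map euclidean euclideanreal snd" by (simp add: continuous_on_snd)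
  qed
  then have "connectedin euclideanreal ((snd \<circ> \<sigma>) ` ?D)"
    by (rule connectedin_continuous_map_image)
      (simp add: connectedin_subtopology connectedin_standard_simplex)
  then have conn: "connected ((\<lambda>z. snd (\<sigma> z)) ` ?D)" by (simp add: connectedin_iff_connected comp_def)
  have tip: "\<sigma> z \<in> griffiths_space" "\<bar>snd (\<sigma> z)\<bar> < 1" "snd (\<sigma> z) \<noteq> 0" if "z \<in> ?D" for z
    using \<sigma>'(2) that by (auto simp: griffiths_tips_def griffiths_waist_def image_subset_iff)
  have "(\<forall>z\<in>?D. 0 < snd (\<sigma> z)) \<or> (\<forall>z\<in>?D. snd (\<sigma> z) < 0)"
  proof (rule ccontr)
    assume "\<not> ?thesis"
    then obtain z1 z2 where "z1 \<in> ?D" "z2 \<in> ?D" "snd (\<sigma> z1) \<le> 0" "0 \<le> snd (\<sigma> z2)"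
      by (auto simp: not_less)
    then have "0 \<in> (\<lambda>z. snd (\<sigma> z)) ` ?D" using connectedD_interval[OF conn] by blast
    then show False using tip(3) by force
  qed
  then have "(\<forall>z\<in>?D. cone_angle (i m) (\<sigma> z) = 1) \<or> (\<forall>z\<in>?D. cone_angle (j n) (- \<sigma> z) = 1)"
    using cone_angle_griffiths_space(4,5)[OF tip(1,2)] ij by blast
  then show ?thesis
    by (rule simplex_area_trivial[OF \<sigma>'(1) wedge_family_griffiths[of i j, OF ij]])
qed

text \<open>The excision isomorphism, read as a statement about chains: only its injectivity is of interest.\<close>

lemma homologous_rel_excise:
  assumes ex: "X closure_of U \<subseteq> X interior_of T" "T \<subseteq> topspace X"
    and c: "singular_relcycle p (subtopology X (topspace X - U)) (T - U) c"
      "singular_relcycle p (subtopology X (topspace X - U)) (T - U) c'"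
    and hom: "homologous_rel p X T c c'"
  shows "homologous_rel p (subtopology X (topspace X - U)) (T - U) c c'"
proof -
  let ?X = "subtopology X (topspace X - U)"
  let ?h = "hom_induced (int p) ?X (T - U) X T id"
  have "?h \<in> iso (relative_homology_group p ?X (T - U)) (relative_homology_group p X T)"
    using homology_excision_axiom[OF ex, of "int p"] by simp
  then have inj: "inj_on ?h (carrier (relative_homology_group p ?X (T - U)))"
    by (simp add: iso_def bij_betw_def)
  have cont: "continuous_map ?X X id" by (simp add: continuous_map_from_subtopology)
  have im: "id ` (T - U) \<subseteq> T" by auto
  have id: "?h (homologous_rel_set p ?X (T - U) d) = homologous_rel_set p X T d"
    if d: "singular_relcycle p ?X (T - U) d" for d
  proof -
    have "singular_chain p ?X d" using d by (simp add: singular_relcycle)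
    then have "chain_map p id d = d" by (rule chain_map_ident)
    then show ?thesis using hom_induced_chain_map[OF cont _ d, of T] by auto
  qed
  have "?h (homologous_rel_set p ?X (T - U) c) = ?h (homologous_rel_set p ?X (T - U) c')"
    unfolding id[OF c(1)] id[OF c(2)] using hom homologous_rel_set_eq by blast
  moreover have "homologous_rel_set p ?X (T - U) d \<in> carrier (relative_homology_group p ?X (T - U))"
    if "singular_relcycle p ?X (T - U) d" for d
    using that by (simp add: carrier_relative_homology_group)
  ultimately have "homologous_rel_set p ?X (T - U) c = homologous_rel_set p ?X (T - U) c'"
    using inj c by (auto dest: inj_onD)
  then show ?thesis using homologous_rel_set_eq by blast
qed

lemma homologous_rel_griffiths_waist:
  assumes c: "singular_relcycle p (top_of_set griffiths_waist) {} c"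
      "singular_relcycle p (top_of_set griffiths_waist) {} c'"
    and hom: "homologous_rel p (top_of_set griffiths_space) {} c c'"
  shows "homologous_rel p (top_of_set griffiths_waist) griffiths_tips c c'"
proof -
  let ?Y = "top_of_set griffiths_space"
  define U where "U = {x \<in> griffiths_space. 3 / 4 \<le> \<bar>snd x\<bar>}"
  define T where "T = {x \<in> griffiths_space. 1 / 2 < \<bar>snd x\<bar>}"
  have "closed {x :: complex \<times> real. 3 / 4 \<le> \<bar>snd x\<bar>}" by (intro closed_Collect_le continuous_intros)
  then have "closedin ?Y (griffiths_space \<inter> {x. 3 / 4 \<le> \<bar>snd x\<bar>})" by (rule closedin_closed_Int)
  moreover have "griffiths_space \<inter> {x. 3 / 4 \<le> \<bar>snd x\<bar>} = U" by (auto simp: U_def)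
  ultimately have "?Y closure_of U = U" by (simp add: closure_of_closedin)
  moreover have "open {x :: complex \<times> real. 1 / 2 < \<bar>snd x\<bar>}" by (intro open_Collect_less continuous_intros)
  then have "openin ?Y (griffiths_space \<inter> {x. 1 / 2 < \<bar>snd x\<bar>})" by (rule openin_open_Int)
  moreover have "griffiths_space \<inter> {x. 1 / 2 < \<bar>snd x\<bar>} = T" by (auto simp: T_def)
  ultimately have ex: "?Y closure_of U \<subseteq> ?Y interior_of T"
    by (simp add: interior_of_openin) (auto simp: U_def T_def)
  have "griffiths_space - U = griffiths_waist" by (auto simp: U_def griffiths_waist_def)
  then have waist: "subtopology ?Y (topspace ?Y - U) = top_of_set griffiths_waist"
    by (auto simp: subtopology_subtopology griffiths_waist_def Int_absorb1)
  have tips: "T - U = griffiths_tips" by (auto simp: U_def T_def griffiths_waist_def griffiths_tips_def)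
  have mono: "singular_relcycle p X A d" if "singular_relcycle p X {} d" for X A and d :: "(complex \<times> real) chain"
    using that by (simp add: singular_relcycle singular_chain_empty)
  have "homologous_rel p ?Y T c c'"
    using hom unfolding homologous_rel_def singular_relboundary
    by (metis singular_chain_0 singular_chain_empty topspace_subtopology inf_bot_right)
  then show ?thesis
    using homologous_rel_excise[OF ex, of p c c'] mono[OF c(1), of griffiths_tips] mono[OF c(2), of griffiths_tips]
    unfolding waist tips by (auto simp: T_def)
qed

section \<open>Almost disjoint sequences and the theorem\<close>

text \<open>If \<open>f\<close> has the identity matrix and \<open>g\<close> meets only finitely many of the circles measured by
  \<open>\<alpha>\<close>, the difference of the matrices agrees with the identity outside finitely many rows.\<close>

lemma area_separates_loops:
  fixes X :: "'a topology"
  assumes W: "wedge_family X \<alpha> \<beta>"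
    and A: "\<And>\<sigma> m n. singular_simplex 1 (subtopology X A) \<sigma> \<Longrightarrow> simplex_area (\<alpha> m) (\<beta> n) \<sigma> = 0"
    and f: "\<And>m n. simplex_area (\<alpha> m) (\<beta> n) (loop_simplex f) = (if m = n then 1 else 0)"
    and g: "pathin X g" "\<And>m t. N \<le> m \<Longrightarrow> t \<in> {0..1} \<Longrightarrow> \<alpha> m (g t) = 1"
  shows "\<not> homologous_rel 1 X A (frag_of (loop_simplex f)) (frag_of (loop_simplex g))"
proof
  assume hom: "homologous_rel 1 X A (frag_of (loop_simplex f)) (frag_of (loop_simplex g))"
  have "\<exists>(S :: ((nat \<Rightarrow> real) \<Rightarrow> 'a) set) u v. finite S \<and>
    (\<forall>m n. simplex_area (\<alpha> m) (\<beta> n) (loop_simplex f) - simplex_area (\<alpha> m) (\<beta> n) (loop_simplex g)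
      = (\<Sum>s\<in>S. u s m * v s n))"
    by (rule homologous_area_finite_rank[OF W _ hom, unfolded chain_sum_frag_of]) (rule A)
  then obtain S :: "((nat \<Rightarrow> real) \<Rightarrow> 'a) set" and u v where S: "finite S"
    and uv: "\<forall>m n. simplex_area (\<alpha> m) (\<beta> n) (loop_simplex f) - simplex_area (\<alpha> m) (\<beta> n) (loop_simplex g)
      = (\<Sum>s\<in>S. u s m * v s n)"
    by (elim exE conjE)
  have "simplex_area (\<alpha> m) (\<beta> n) (loop_simplex g) = 0" if "N \<le> m" for m n
  proof (rule simplex_area_trivial[OF singular_simplex_loop_simplex[OF g(1)] W])
    have "\<alpha> m (loop_simplex g z) = 1" if z: "z \<in> standard_simplex 1" for z
    proof -
      have "z 1 \<in> {0..1}" using z by (simp add: standard_simplex_def)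
      then have "\<alpha> m (g (z 1)) = 1" by (rule g(2)[OF \<open>N \<le> m\<close>])
      then show ?thesis using z by (simp only: restrict_apply if_True)
    qed
    then show "(\<forall>z\<in>standard_simplex 1. \<alpha> m (loop_simplex g z) = 1) \<or>
        (\<forall>z\<in>standard_simplex 1. \<beta> n (loop_simplex g z) = 1)" by blast
  qed
  then have "(\<Sum>s\<in>S. u s m * v s n) = (if m = n then 1 else 0)" if "N \<le> m" "N \<le> n" for m n
    using uv[rule_format, of m n] f[of m n] that by simp
  then show False by (rule identity_matrix_not_finite_rank[OF S])
qed

lemma commutator_word_cases:
  obtains g where "g \<in> {fst (c (i div 4)), snd (c (i div 4))}"
    "commutator_word c i = Gen g \<or> commutator_word c i = Inv g"
proof (cases i rule: commutator_word_position)
  case (1 m)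
  then have "i div 4 = m" by simp
  then show ?thesis using that[of "fst (c m)"] commutator_word_nth(1)[of c m] 1 by simp
next
  case (2 m)
  then have "i div 4 = m" by simp
  then show ?thesis using that[of "snd (c m)"] commutator_word_nth(2)[of c m] 2 by simp
next
  case (3 m)
  then have "i div 4 = m" by simp
  then show ?thesis using that[of "fst (c m)"] commutator_word_nth(3)[of c m] 3 by simp
next
  case (4 m)
  then have "i div 4 = m" by simp
  then show ?thesis using that[of "snd (c m)"] commutator_word_nth(4)[of c m] 4 by simp
qed

text \<open>The second part provides a loop for the class of the word, together with what is needed to evaluate
  angles along it: its values are values of the loops of generators in the word.\<close>

lemma commutator_word_defines_element:
  fixes \<rho> :: "'g \<Rightarrow> real \<Rightarrow> 'a::real_normed_vector"
  assumes fin: "\<And>u. finite {m. u \<in> {fst (c m), snd (c m)}}" and S: "0 \<in> S"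
    and \<rho>: "\<And>m g. g \<in> {fst (c m), snd (c m)} \<Longrightarrow> continuous_on {0..1} (\<rho> g) \<and> \<rho> g 0 = 0 \<and> \<rho> g 1 = 0 \<and>
        (\<forall>s\<in>{0..1}. \<rho> g s \<in> S \<and> norm (\<rho> g s) \<le> 2 / real (Suc m))"
  shows "defines_element (top_of_set S) \<rho> 0 (commutator_word c)"
    "\<exists>a b f. ordered_intervals a b \<and> traverses \<rho> 0 (commutator_word c) a b f \<and>
       pathin (top_of_set S) f \<and> f 0 = 0 \<and> f 1 = 0 \<and>
       f ` {0..1} \<subseteq> insert 0 (\<Union>m. \<Union>g\<in>{fst (c m), snd (c m)}. \<rho> g ` {0..1}) \<and>
       word_class (top_of_set S) \<rho> 0 (commutator_word c) = loop_class (top_of_set S) f"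
proof -
  let ?w = "commutator_word c"
  have L: "continuous_on {0..1} (letter_loop \<rho> (?w i)) \<and> letter_loop \<rho> (?w i) 0 = 0 \<and>
      letter_loop \<rho> (?w i) 1 = 0 \<and>
      (\<forall>s\<in>{0..1}. letter_loop \<rho> (?w i) s \<in> (\<Union>g\<in>{fst (c (i div 4)), snd (c (i div 4))}. \<rho> g ` {0..1}))" for i
  proof -
    obtain g where g: "g \<in> {fst (c (i div 4)), snd (c (i div 4))}" "?w i = Gen g \<or> ?w i = Inv g"
      by (rule commutator_word_cases)
    note \<rho>g = \<rho>[OF g(1)]
    have "continuous_on {0..1} (reversepath (\<rho> g))"
      using \<rho>g path_reversepath[of "\<rho> g"] by (simp add: path_def)
    moreover have "reversepath (\<rho> g) s \<in> \<rho> g ` {0..1}" if "s \<in> {0..1}" for s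
      using that by (auto simp: reversepath_def)
    ultimately show ?thesis using g \<rho>g by (auto simp: reversepath_def)
  qed
  have image: "letter_loop \<rho> (?w i) s \<in> (\<Union>g\<in>{fst (c (i div 4)), snd (c (i div 4))}. \<rho> g ` {0..1})"
    if "s \<in> {0..1}" for i s
    using conjunct2[OF conjunct2[OF conjunct2[OF L[of i]]]] that by (rule bspec)
  have vals: "x \<in> S \<and> norm x \<le> 2 / real (Suc m)"
    if "x \<in> (\<Union>g\<in>{fst (c m), snd (c m)}. \<rho> g ` {0..1})" for x m
    using that \<rho> by blast
  have fin': "finite {i. ?w i = l}" for l
  proof -
    obtain u where u: "l = Gen u \<or> l = Inv u" by (cases l) auto
    have "i \<in> (\<lambda>(m, r). 4 * m + r) ` ({m. u \<in> {fst (c m), snd (c m)}} \<times> {..<4})" if "?w i = l" for i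
    proof -
      obtain g where "g \<in> {fst (c (i div 4)), snd (c (i div 4))}" "?w i = Gen g \<or> ?w i = Inv g"
        by (rule commutator_word_cases)
      then have "u \<in> {fst (c (i div 4)), snd (c (i div 4))}" using u that by auto
      then show ?thesis by (intro image_eqI[of _ _ "(i div 4, i mod 4)"]) auto
    qed
    then have "{i. ?w i = l} \<subseteq> (\<lambda>(m, r). 4 * m + r) ` ({m. u \<in> {fst (c m), snd (c m)}} \<times> {..<4})"
      by blast
    then show ?thesis by (rule finite_subset) (intro finite_imageI finite_cartesian_product fin finite_lessThan)
  qed
  have small: "\<exists>N. \<forall>i\<ge>N. \<forall>s\<in>{0..1}. norm (letter_loop \<rho> (?w i) s) < e" if "0 < e" for e
  proof -
    obtain M where M: "2 / e < real M" using reals_Archimedean2 by blast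
    have "norm (letter_loop \<rho> (?w i) s) < e" if "4 * M \<le> i" "s \<in> {0..1}" for i s
    proof -
      have "M \<le> i div 4" using that(1) by simp
      then have "2 / e < real (Suc (i div 4))" using M by linarith
      then have "2 / real (Suc (i div 4)) < e" using \<open>0 < e\<close> by (simp add: field_simps)
      moreover have "norm (letter_loop \<rho> (?w i) s) \<le> 2 / real (Suc (i div 4))" 
        using vals[OF image[OF that(2)]] by simp
      ultimately show ?thesis by linarith
    qed
    then show ?thesis by blast
  qed
  have L4: "letter_loop \<rho> (?w i) s \<in> S" if "s \<in> {0..1}" for i s
    using vals[OF image[OF that]] by simp
  note res = word_defines_element[where w = ?w and \<rho> = \<rho>, OF fin' S conjunct1[OF L]
    conjunct1[OF conjunct2[OF L]] conjunct1[OF conjunct2[OF conjunct2[OF L]]] L4 small]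
  show "defines_element (top_of_set S) \<rho> 0 ?w" by (rule res(1))
  have "\<exists>a b f. ordered_intervals a b \<and> traverses \<rho> 0 ?w a b f \<and> pathin (top_of_set S) f \<and>
      f 0 = 0 \<and> f 1 = 0 \<and> f ` {0..1} \<subseteq> insert 0 (\<Union>i. letter_loop \<rho> (?w i) ` {0..1}) \<and>
      word_class (top_of_set S) \<rho> 0 ?w = loop_class (top_of_set S) f"
    by (rule res(2))
  then obtain a b f where f: "ordered_intervals a b" "traverses \<rho> 0 ?w a b f" "pathin (top_of_set S) f"
      "f 0 = 0" "f 1 = 0" "f ` {0..1} \<subseteq> insert 0 (\<Union>i. letter_loop \<rho> (?w i) ` {0..1})"
      "word_class (top_of_set S) \<rho> 0 ?w = loop_class (top_of_set S) f"
    by (elim exE conjE)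
  have "(\<Union>i. letter_loop \<rho> (?w i) ` {0..1}) \<subseteq> (\<Union>m. \<Union>g\<in>{fst (c m), snd (c m)}. \<rho> g ` {0..1})"
  proof clarify
    fix i s assume "s \<in> {0..1::real}"
    from image[OF this, of i]
    show "letter_loop \<rho> (?w i) s \<in> (\<Union>m. \<Union>g\<in>{fst (c m), snd (c m)}. \<rho> g ` {0..1})" by (rule UN_I[OF UNIV_I])
  qed
  then have "f ` {0..1} \<subseteq> insert 0 (\<Union>m. \<Union>g\<in>{fst (c m), snd (c m)}. \<rho> g ` {0..1})"
    by (intro subset_trans[OF f(6)] insert_mono)
  then show "\<exists>a b f. ordered_intervals a b \<and> traverses \<rho> 0 (commutator_word c) a b f \<and>
       pathin (top_of_set S) f \<and> f 0 = 0 \<and> f 1 = 0 \<and>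
       f ` {0..1} \<subseteq> insert 0 (\<Union>m. \<Union>g\<in>{fst (c m), snd (c m)}. \<rho> g ` {0..1}) \<and>
       word_class (top_of_set S) \<rho> 0 (commutator_word c) = loop_class (top_of_set S) f"
    by (intro exI[of _ a] exI[of _ b] exI[of _ f] conjI f)
qed

text \<open>An almost disjoint family of sequences, indexed by all sets of natural numbers: the \<open>n\<close>-th term
  codes \<open>n\<close> together with \<open>S \<inter> {..<n}\<close>. Sequences of different sets share only the finitely many terms
  up to the first number on which the sets disagree. The successor keeps the values positive.\<close>

definition prefix_code :: "nat set \<Rightarrow> nat \<Rightarrow> nat" where
  "prefix_code S = restrict (\<lambda>n. Suc (prod_encode (n, set_encode (S \<inter> {..<n})))) {1..}"

lemma prefix_code_gt: "n \<ge> 1 \<Longrightarrow> n < prefix_code S n"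
  using le_prod_encode_1[of n] by (simp add: prefix_code_def less_Suc_eq_le)

lemma prefix_code_eq_iff:
  assumes "m \<ge> 1" "n \<ge> 1"
  shows "prefix_code S m = prefix_code T n \<longleftrightarrow> m = n \<and> S \<inter> {..<m} = T \<inter> {..<n}"
  using assms set_encode_eq[of "S \<inter> {..<m}" "T \<inter> {..<n}"] by (auto simp: prefix_code_def)

lemma prefix_code_inject: "m \<ge> 1 \<Longrightarrow> n \<ge> 1 \<Longrightarrow> prefix_code S m = prefix_code S n \<longleftrightarrow> m = n"
  using prefix_code_eq_iff by blast

lemma prefix_code_almost_disjoint:
  assumes "S \<noteq> T"
  obtains N where "\<And>m n. N \<le> m \<Longrightarrow> m \<ge> 1 \<Longrightarrow> n \<ge> 1 \<Longrightarrow> prefix_code S m \<noteq> prefix_code T n"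
proof -
  obtain x where "x \<in> S \<longleftrightarrow> x \<notin> T" using assms by blast
  then have "S \<inter> {..<m} \<noteq> T \<inter> {..<m}" if "Suc x \<le> m" for m
    using that by (metis IntE IntI Suc_le_eq lessThan_iff)
  then show ?thesis using that[of "Suc x"] prefix_code_eq_iff by metis
qed

lemma inj_prefix_code: "inj prefix_code"
proof (rule injI, rule ccontr)
  fix S T assume eq: "prefix_code S = prefix_code T" and "S \<noteq> T"
  obtain N where N: "\<And>m n. N \<le> m \<Longrightarrow> m \<ge> 1 \<Longrightarrow> n \<ge> 1 \<Longrightarrow> prefix_code S m \<noteq> prefix_code T n"
    using prefix_code_almost_disjoint[OF \<open>S \<noteq> T\<close>] by blast
  show False using N[of "Suc N" "Suc N"] eq by simp
qed

definition pp_pairs :: "nat set \<Rightarrow> nat \<Rightarrow> nat \<times> nat" where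
  "pp_pairs S m = (prefix_code S (2 * m + 1), prefix_code S (2 * m + 2))"

definition pq_pairs :: "nat set \<Rightarrow> nat \<Rightarrow> gen \<times> gen" where
  "pq_pairs S m = (P (prefix_code S (m + 1)), Q (prefix_code S (m + 1)))"

lemma pp_word_prefix_code: "pp_word (prefix_code S) = commutator_word (pp_pairs S)"
  by (simp add: pp_word_def pp_pairs_def[abs_def])

lemma pq_word_prefix_code: "pq_word (prefix_code S) = commutator_word (pq_pairs S)"
  by (simp add: pq_word_def pq_pairs_def[abs_def])

lemma circle_loop_small:
  assumes "m < n" "s \<in> {0..1}"
  shows "circle_loop n s \<in> hawaiian_earring" "norm (circle_loop n s) \<le> 2 / real (Suc m)"
proof -
  show "circle_loop n s \<in> hawaiian_earring" using assms by (intro circle_loop_in_hawaiian_earring) auto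
  have "norm (circle_loop n s) \<le> 2 / real n" by (rule circle_loop_properties)
  also have "\<dots> \<le> 2 / real (Suc m)" using assms by (intro divide_left_mono) auto
  finally show "norm (circle_loop n s) \<le> 2 / real (Suc m)" .
qed

lemma zero_in_hawaiian_earring: "0 \<in> hawaiian_earring"
  using circle_loop_in_hawaiian_earring[of 1 0] by (simp add: circle_loop_properties)

lemma hawaiian_earring_griffiths_space:
  assumes "z \<in> hawaiian_earring"
  shows "(z, 0) \<in> griffiths_space" "(- z, 0) \<in> griffiths_space"
proof -
  have "(z, 0) \<in> cone_over hawaiian_earring"
    unfolding cone_over_def using assms by (intro image_eqI[of _ _ "(z, 0)"]) (auto simp: cone_map_def)
  moreover from this have "(- z, 0) \<in> uminus ` cone_over hawaiian_earring"
    by (intro image_eqI[of _ _ "(z, 0)"]) auto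
  ultimately show "(z, 0) \<in> griffiths_space" "(- z, 0) \<in> griffiths_space"
    by (auto simp: griffiths_space_def)
qed

lemma pp_word_defines_element:
  defines "Z \<equiv> top_of_set hawaiian_earring"
  shows "defines_element Z circle_loop 0 (pp_word (prefix_code S))"
    "\<exists>a b f. ordered_intervals a b \<and> traverses circle_loop 0 (commutator_word (pp_pairs S)) a b f \<and>
       pathin Z f \<and> f 0 = 0 \<and> f 1 = 0 \<and>
       f ` {0..1} \<subseteq> insert 0 (\<Union>m. \<Union>g\<in>{fst (pp_pairs S m), snd (pp_pairs S m)}. circle_loop g ` {0..1}) \<and>
       word_class Z circle_loop 0 (pp_word (prefix_code S)) = loop_class Z f"
proof -
  have gt: "m < g" if "g \<in> {fst (pp_pairs S m), snd (pp_pairs S m)}" for m g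
    using that prefix_code_gt[of "2 * m + 1" S] prefix_code_gt[of "2 * m + 2" S] by (auto simp: pp_pairs_def)
  have fin: "finite {m. u \<in> {fst (pp_pairs S m), snd (pp_pairs S m)}}" for u
    by (rule finite_subset[of _ "{..<u}"]) (use gt in auto)
  have \<rho>: "continuous_on {0..1} (circle_loop g) \<and> circle_loop g 0 = 0 \<and> circle_loop g 1 = 0 \<and>
        (\<forall>s\<in>{0..1}. circle_loop g s \<in> hawaiian_earring \<and> norm (circle_loop g s) \<le> 2 / real (Suc m))"
    if "g \<in> {fst (pp_pairs S m), snd (pp_pairs S m)}" for m g
    using circle_loop_small[OF gt[OF that]] circle_loop_properties by blast
  note res = commutator_word_defines_element[of "pp_pairs S", OF fin zero_in_hawaiian_earring \<rho>]
  show "defines_element Z circle_loop 0 (pp_word (prefix_code S))"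
    unfolding Z_def pp_word_prefix_code by (rule res(1))
  show "\<exists>a b f. ordered_intervals a b \<and> traverses circle_loop 0 (commutator_word (pp_pairs S)) a b f \<and>
       pathin Z f \<and> f 0 = 0 \<and> f 1 = 0 \<and>
       f ` {0..1} \<subseteq> insert 0 (\<Union>m. \<Union>g\<in>{fst (pp_pairs S m), snd (pp_pairs S m)}. circle_loop g ` {0..1}) \<and>
       word_class Z circle_loop 0 (pp_word (prefix_code S)) = loop_class Z f"
    unfolding Z_def pp_word_prefix_code by (rule res(2))
qed

text \<open>The matrix has the angles of the first generators of the commutators as rows and those of the second
  generators as columns.\<close>

lemma pp_word_classes_distinct:
  assumes "S \<noteq> T"
  shows "word_class (top_of_set hawaiian_earring) circle_loop 0 (pp_word (prefix_code S)) \<noteq>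
    word_class (top_of_set hawaiian_earring) circle_loop 0 (pp_word (prefix_code T))"
proof
  let ?Z = "top_of_set hawaiian_earring"
  assume eq: "word_class ?Z circle_loop 0 (pp_word (prefix_code S)) = word_class ?Z circle_loop 0 (pp_word (prefix_code T))"
  from pp_word_defines_element(2)[of S] obtain a b f where f: "ordered_intervals a b"
    "traverses circle_loop 0 (commutator_word (pp_pairs S)) a b f"
    "word_class ?Z circle_loop 0 (pp_word (prefix_code S)) = loop_class ?Z f"
    by (elim exE conjE)
  from pp_word_defines_element(2)[of T] obtain g where g: "pathin ?Z g"
    "g ` {0..1} \<subseteq> insert 0 (\<Union>m. \<Union>g\<in>{fst (pp_pairs T m), snd (pp_pairs T m)}. circle_loop g ` {0..1})"
    "word_class ?Z circle_loop 0 (pp_word (prefix_code T)) = loop_class ?Z g"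
    by (elim exE conjE)
  obtain N where N: "\<And>m n. N \<le> m \<Longrightarrow> m \<ge> 1 \<Longrightarrow> n \<ge> 1 \<Longrightarrow> prefix_code S m \<noteq> prefix_code T n"
    using prefix_code_almost_disjoint[OF assms] by blast
  let ?i = "\<lambda>m. fst (pp_pairs S m)"
  let ?j = "\<lambda>n. snd (pp_pairs S n)"
  have ge: "?i m \<ge> 1" "?j m \<ge> 1" for m
    using prefix_code_gt[of "2 * m + 1" S] prefix_code_gt[of "2 * m + 2" S] by (auto simp: pp_pairs_def)
  have inj: "?i k = ?i m \<longleftrightarrow> k = m" "?j k = ?j m \<longleftrightarrow> k = m" "?i k \<noteq> ?j m" "?j m \<noteq> ?i k" for k m
  proof -
    have "2 * k + 1 \<noteq> 2 * m + 2" by presburger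
    then show "?i k = ?i m \<longleftrightarrow> k = m" "?j k = ?j m \<longleftrightarrow> k = m" "?i k \<noteq> ?j m" "?j m \<noteq> ?i k"
      by (simp_all add: pp_pairs_def prefix_code_inject del: add_2_eq_Suc')
  qed
  have "\<not> homologous_rel 1 ?Z {} (frag_of (loop_simplex f)) (frag_of (loop_simplex g))"
  proof (rule area_separates_loops)
    show "wedge_family ?Z (\<lambda>m. angle (?i m)) (\<lambda>n. angle (?j n))"
      by (rule wedge_family_hawaiian_earring) (use ge inj in auto)
    show "simplex_area (angle (?i m)) (angle (?j n)) \<sigma> = 0"
      if "singular_simplex 1 (subtopology ?Z {}) \<sigma>" for \<sigma> m n
      using that singular_simplex_empty[of "subtopology ?Z {}"] by simp
    show "simplex_area (angle (?i m)) (angle (?j n)) (loop_simplex f) = (if m = n then 1 else 0)" for m n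
      by (rule simplex_area_commutator_word[OF f(1,2)]) (use ge inj in \<open>auto simp: angle_circle_loop angle_0\<close>)
    show "angle (?i m) (g t) = 1" if "N \<le> m" "t \<in> {0..1}" for m t
    proof -
      have "prefix_code S (2 * m + 1) \<noteq> prefix_code T n" if "n \<ge> 1" for n
        using N[of "2 * m + 1" n] \<open>N \<le> m\<close> that by simp
      then have ne: "h \<noteq> ?i m" if "h \<in> {fst (pp_pairs T n), snd (pp_pairs T n)}" for h n
        using that by (force simp: pp_pairs_def)
      have "g t \<in> insert 0 (\<Union>m. \<Union>g\<in>{fst (pp_pairs T m), snd (pp_pairs T m)}. circle_loop g ` {0..1})"
        using g(2) that(2) by (rule subsetD[OF _ imageI])
      then consider "g t = 0" | n h s where "h \<in> {fst (pp_pairs T n), snd (pp_pairs T n)}" "g t = circle_loop h s"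
        by (elim insertE[of "g t"] UN_E imageE) blast+
      then show ?thesis
      proof cases
        case 1
        then show ?thesis by (simp only: angle_0)
      next
        case 2
        then show ?thesis using ne[OF 2(1)] by (simp only: angle_circle_loop[OF ge(1)] if_False)
      qed
    qed
  qed (rule g(1))
  moreover have "loop_class ?Z f = loop_class ?Z g" using eq f(3) g(3) by simp
  ultimately show False by (simp only: loop_class_eq_iff)
qed

lemma griffiths_loop_abs: "griffiths_loop (P n) = (\<lambda>t. (circle_loop n t, 0))" "griffiths_loop (Q n) = (\<lambda>t. (- circle_loop n t, 0))"
  by auto

lemma pq_word_defines_element:
  defines "Y \<equiv> top_of_set griffiths_space"
  shows "defines_element Y griffiths_loop (0, 0) (pq_word (prefix_code S))"
    "\<exists>a b f. ordered_intervals a b \<and> traverses griffiths_loop (0, 0) (commutator_word (pq_pairs S)) a b f \<and>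
       pathin Y f \<and> f 0 = (0, 0) \<and> f 1 = (0, 0) \<and>
       f ` {0..1} \<subseteq> insert (0, 0) (\<Union>m. \<Union>g\<in>{fst (pq_pairs S m), snd (pq_pairs S m)}. griffiths_loop g ` {0..1}) \<and>
       word_class Y griffiths_loop (0, 0) (pq_word (prefix_code S)) = loop_class Y f"
proof -
  have gt: "m < prefix_code S (m + 1)" for m using prefix_code_gt[of "m + 1" S] by simp
  have fin: "finite {m. u \<in> {fst (pq_pairs S m), snd (pq_pairs S m)}}" for u
  proof (rule finite_subset[of _ "{..<case u of P n \<Rightarrow> n | Q n \<Rightarrow> n}"])
    have "m < (case u of P n \<Rightarrow> n | Q n \<Rightarrow> n)" if "u \<in> {fst (pq_pairs S m), snd (pq_pairs S m)}" for m
      using that gt[of m] by (auto simp: pq_pairs_def)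
    then show "{m. u \<in> {fst (pq_pairs S m), snd (pq_pairs S m)}} \<subseteq> {..<case u of P n \<Rightarrow> n | Q n \<Rightarrow> n}"
      by blast
  qed simp
  have zero: "0 \<in> griffiths_space"
    using hawaiian_earring_griffiths_space(1)[OF zero_in_hawaiian_earring] by (simp add: zero_prod_def)
  have \<rho>: "continuous_on {0..1} (griffiths_loop g) \<and> griffiths_loop g 0 = 0 \<and> griffiths_loop g 1 = 0 \<and>
        (\<forall>s\<in>{0..1}. griffiths_loop g s \<in> griffiths_space \<and> norm (griffiths_loop g s) \<le> 2 / real (Suc m))"
    if "g \<in> {fst (pq_pairs S m), snd (pq_pairs S m)}" for m g
  proof -
    have "g = P (prefix_code S (m + 1)) \<or> g = Q (prefix_code S (m + 1))" using that by (auto simp: pq_pairs_def)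
    moreover have "continuous_on {0..1} (griffiths_loop g)" for g
      by (cases g) (simp_all only: griffiths_loop_abs, (intro continuous_intros circle_loop_properties)+)
    moreover have "griffiths_loop g s \<in> griffiths_space \<and> norm (griffiths_loop g s) \<le> 2 / real (Suc m)"
      if "g = P (prefix_code S (m + 1)) \<or> g = Q (prefix_code S (m + 1))" "s \<in> {0..1}" for s
      using that(1) circle_loop_small[OF gt[of m] that(2)] hawaiian_earring_griffiths_space
      by (auto simp: norm_Pair)
    moreover have "griffiths_loop g 0 = 0" "griffiths_loop g 1 = 0" for g
      by (cases g; simp add: circle_loop_properties zero_prod_def)+
    ultimately show ?thesis by blast
  qed
  note res = commutator_word_defines_element[of "pq_pairs S", OF fin zero \<rho>]
  show "defines_element Y griffiths_loop (0, 0) (pq_word (prefix_code S))"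
    unfolding Y_def pq_word_prefix_code zero_prod_def[symmetric] by (rule res(1))
  show "\<exists>a b f. ordered_intervals a b \<and> traverses griffiths_loop (0, 0) (commutator_word (pq_pairs S)) a b f \<and>
       pathin Y f \<and> f 0 = (0, 0) \<and> f 1 = (0, 0) \<and>
       f ` {0..1} \<subseteq> insert (0, 0) (\<Union>m. \<Union>g\<in>{fst (pq_pairs S m), snd (pq_pairs S m)}. griffiths_loop g ` {0..1}) \<and>
       word_class Y griffiths_loop (0, 0) (pq_word (prefix_code S)) = loop_class Y f"
    unfolding Y_def pq_word_prefix_code zero_prod_def[symmetric] by (rule res(2))
qed

lemma cone_angle_griffiths_loop:
  assumes "n \<ge> 1"
  shows "cone_angle n (griffiths_loop g s) = (if g = P n then cis (2 * pi * s) else 1)"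
    "cone_angle n (- griffiths_loop g s) = (if g = Q n then cis (2 * pi * s) else 1)"
proof -
  have "angle n (- circle_loop m s) = 1" for m
    by (rule angle_left_half_plane[OF assms]) (simp add: circle_loop_def)
  then have *: "cone_angle n (circle_loop m s, 0) = (if m = n then cis (2 * pi * s) else 1)"
    "cone_angle n (- circle_loop m s, 0) = 1" for m
    using assms by (simp_all add: cone_angle_def angle_circle_loop)
  show "cone_angle n (griffiths_loop g s) = (if g = P n then cis (2 * pi * s) else 1)"
    "cone_angle n (- griffiths_loop g s) = (if g = Q n then cis (2 * pi * s) else 1)"
    by (cases g; simp add: *)+
qed

text \<open>The rows belong to the circles \<open>p\<^sub>n\<close> and the columns to the circles \<open>q\<^sub>n\<close>. The loops avoid the apexes,
  so that they can be compared in the waist, relative to the tips.\<close>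

lemma pq_word_classes_distinct:
  assumes "S \<noteq> T"
  shows "word_class (top_of_set griffiths_space) griffiths_loop (0, 0) (pq_word (prefix_code S)) \<noteq>
    word_class (top_of_set griffiths_space) griffiths_loop (0, 0) (pq_word (prefix_code T))"
proof
  let ?Y = "top_of_set griffiths_space"
  let ?W = "top_of_set griffiths_waist"
  assume eq: "word_class ?Y griffiths_loop (0, 0) (pq_word (prefix_code S)) = word_class ?Y griffiths_loop (0, 0) (pq_word (prefix_code T))"
  have waist: "pathin ?W f" if "pathin ?Y f"
    "f ` {0..1} \<subseteq> insert (0, 0) (\<Union>m. \<Union>g\<in>{fst (pq_pairs R m), snd (pq_pairs R m)}. griffiths_loop g ` {0..1})" for f R
  proof -
    have "snd (griffiths_loop g s) = 0" for g s by (cases g) auto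
    then have "snd (f t) = 0" if "t \<in> {0..1}" for t
      using that \<open>f ` {0..1} \<subseteq> _\<close> by fastforce
    then show ?thesis using that(1) by (auto simp: pathin_def griffiths_waist_def)
  qed
  from pq_word_defines_element(2)[of S] obtain a b f where f: "ordered_intervals a b"
    "traverses griffiths_loop (0, 0) (commutator_word (pq_pairs S)) a b f"
    "pathin ?Y f" "f 0 = (0, 0)" "f 1 = (0, 0)"
    "f ` {0..1} \<subseteq> insert (0, 0) (\<Union>m. \<Union>g\<in>{fst (pq_pairs S m), snd (pq_pairs S m)}. griffiths_loop g ` {0..1})"
    "word_class ?Y griffiths_loop (0, 0) (pq_word (prefix_code S)) = loop_class ?Y f"
    by (elim exE conjE)
  from pq_word_defines_element(2)[of T] obtain g where g: "pathin ?Y g" "g 0 = (0, 0)" "g 1 = (0, 0)"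
    "g ` {0..1} \<subseteq> insert (0, 0) (\<Union>m. \<Union>g\<in>{fst (pq_pairs T m), snd (pq_pairs T m)}. griffiths_loop g ` {0..1})"
    "word_class ?Y griffiths_loop (0, 0) (pq_word (prefix_code T)) = loop_class ?Y g"
    by (elim exE conjE)
  note fW = waist[OF f(3,6)] and gW = waist[OF g(1,4)]
  obtain N where N: "\<And>m n. N \<le> m \<Longrightarrow> m \<ge> 1 \<Longrightarrow> n \<ge> 1 \<Longrightarrow> prefix_code S m \<noteq> prefix_code T n"
    using prefix_code_almost_disjoint[OF assms] by blast
  let ?i = "\<lambda>m. prefix_code S (m + 1)"
  have ge: "?i m \<ge> 1" for m using prefix_code_gt[of "m + 1" S] by simp
  have inj: "?i k = ?i m \<longleftrightarrow> k = m" for k m by (simp add: prefix_code_inject)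
  have not_hom: "\<not> homologous_rel 1 ?W griffiths_tips (frag_of (loop_simplex f)) (frag_of (loop_simplex g))"
  proof (rule area_separates_loops)
    show "wedge_family ?W (\<lambda>m. cone_angle (?i m)) (\<lambda>n x. cone_angle (?i n) (- x))"
      by (rule wedge_family_griffiths) (rule ge)+
    show "simplex_area (cone_angle (?i m)) (\<lambda>x. cone_angle (?i n) (- x)) \<sigma> = 0"
      if "singular_simplex 1 (subtopology ?W griffiths_tips) \<sigma>" for \<sigma> m n
      by (rule simplex_area_griffiths_tips[of ?i ?i, OF ge ge that])
    show "simplex_area (cone_angle (?i m)) (\<lambda>x. cone_angle (?i n) (- x)) (loop_simplex f) = (if m = n then 1 else 0)" for m n
    proof (rule simplex_area_commutator_word[OF f(1,2)])
      show "cone_angle (?i m) (griffiths_loop g s) = (if g = fst (pq_pairs S m) then cis (2 * pi * s) else 1)"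
        "cone_angle (?i n) (- griffiths_loop g s) = (if g = snd (pq_pairs S n) then cis (2 * pi * s) else 1)" for g s
        using cone_angle_griffiths_loop[OF ge] by (simp_all add: pq_pairs_def)
    qed (use inj in \<open>auto simp: pq_pairs_def cone_angle_def angle_0\<close>)
    show "cone_angle (?i m) (g t) = 1" if "N \<le> m" "t \<in> {0..1}" for m t
    proof -
      have "?i m \<noteq> prefix_code T (n + 1)" for n using N[of "m + 1" "n + 1"] \<open>N \<le> m\<close> by simp
      then have ne: "h \<noteq> P (?i m)" if "h \<in> {fst (pq_pairs T n), snd (pq_pairs T n)}" for h n
        using that by (force simp: pq_pairs_def)
      have "g t \<in> insert (0, 0) (\<Union>m. \<Union>g\<in>{fst (pq_pairs T m), snd (pq_pairs T m)}. griffiths_loop g ` {0..1})"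
        using g(4) that(2) by (rule subsetD[OF _ imageI])
      then consider "g t = (0, 0)" | n h s where "h \<in> {fst (pq_pairs T n), snd (pq_pairs T n)}" "g t = griffiths_loop h s"
        by (elim insertE[of "g t"] UN_E imageE) blast+
      then show ?thesis
      proof cases
        case 1
        then show ?thesis by (simp add: cone_angle_def angle_0)
      next
        case 2
        then show ?thesis using ne[OF 2(1)] by (simp only: cone_angle_griffiths_loop[OF ge] if_False)
      qed
    qed
  qed (rule gW)
  have "loop_class ?Y f = loop_class ?Y g" using eq f(7) g(5) by simp
  then have "homologous_rel 1 ?Y {} (frag_of (loop_simplex f)) (frag_of (loop_simplex g))"
    by (simp only: loop_class_eq_iff)
  then have "homologous_rel 1 ?W griffiths_tips (frag_of (loop_simplex f)) (frag_of (loop_simplex g))"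
    by (intro homologous_rel_griffiths_waist singular_relcycle_loop_simplex fW gW)
      (simp_all add: f(4,5) g(2,3))
  with not_hom show False by (rule notE)
qed

theorem corollary8p7:
  defines "Z \<equiv> top_of_set hawaiian_earring"
    and "Y \<equiv> top_of_set griffiths_space"
  shows "\<exists>K. K \<subseteq> {1::nat..} \<rightarrow>\<^sub>E {1::nat..} \<and> K \<approx> (UNIV :: nat set set) \<and>
    (\<forall>k\<in>K. defines_element Z circle_loop 0 (pp_word k)) \<and>
    inj_on (\<lambda>k. word_class Z circle_loop 0 (pp_word k)) K \<and>
    (\<forall>k\<in>K. defines_element Y griffiths_loop (0, 0) (pq_word k)) \<and>
    inj_on (\<lambda>k. word_class Y griffiths_loop (0, 0) (pq_word k)) K"
proof (intro exI conjI)
  let ?K = "range prefix_code"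
  show "?K \<subseteq> {1..} \<rightarrow>\<^sub>E {1..}"
  proof clarify
    fix S
    have "1 \<le> prefix_code S n" if "n \<in> {1..}" for n using prefix_code_gt[of n S] that by simp
    then show "prefix_code S \<in> {1..} \<rightarrow>\<^sub>E {1..}" by (intro PiE_I) (simp_all add: prefix_code_def)
  qed
  show "?K \<approx> (UNIV :: nat set set)"
    using inj_on_image_eqpoll_self[OF inj_prefix_code] by simp
  show "\<forall>k\<in>?K. defines_element Z circle_loop 0 (pp_word k)"
    unfolding Z_def by (intro ballI, elim imageE, hypsubst) (rule pp_word_defines_element(1))
  show "inj_on (\<lambda>k. word_class Z circle_loop 0 (pp_word k)) ?K"
    unfolding Z_def
  proof (rule inj_onI, elim imageE, hypsubst)
    fix S T
    assume "word_class (top_of_set hawaiian_earring) circle_loop 0 (pp_word (prefix_code S)) =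
        word_class (top_of_set hawaiian_earring) circle_loop 0 (pp_word (prefix_code T))"
    from notE[OF pp_word_classes_distinct this] have "S = T" by (rule ccontr)
    then show "prefix_code S = prefix_code T" by (rule arg_cong)
  qed
  show "\<forall>k\<in>?K. defines_element Y griffiths_loop (0, 0) (pq_word k)"
    unfolding Y_def by (intro ballI, elim imageE, hypsubst) (rule pq_word_defines_element(1))
  show "inj_on (\<lambda>k. word_class Y griffiths_loop (0, 0) (pq_word k)) ?K"
    unfolding Y_def
  proof (rule inj_onI, elim imageE, hypsubst)
    fix S T
    assume "word_class (top_of_set griffiths_space) griffiths_loop (0, 0) (pq_word (prefix_code S)) =
        word_class (top_of_set griffiths_space) griffiths_loop (0, 0) (pq_word (prefix_code T))"
    from notE[OF pq_word_classes_distinct this] have "S = T" by (rule ccontr)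
    then show "prefix_code S = prefix_code T" by (rule arg_cong)
  qed
qed

end
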